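(* Let $U\subseteq M$ be open, let $f:U\to\mathbb C$ be smooth, let $n\ge3$, and let $Z_1,\dots,Z_n$ be smooth (complexified) vector fields on $U$. Then $$(\nabla^nf)(Z_1,\dots,Z_{n-1},Z_n)-(\nabla^nf)(Z_1,\dots,Z_n,Z_{n-1})=0,$$ and for every $i=1,\dots,n-2$, $$(\nabla^nf)(Z_1,\dots,Z_i,Z_{i+1},\dots,Z_n)-(\nabla^nf)(Z_1,\dots,Z_{i+1},Z_i,\dots,Z_n)$$ $$=\sum_{j=i+2}^n(\nabla^{n-2}f)(Z_1,\dots,Z_{i-1},Z_{i+2},\dots,Z_{j-1},-R(Z_i,Z_{i+1})Z_j,Z_{j+1},\dots,Z_n).$$
   Context: $M$ is a two-dimensional, connected, complete, orientable Riemannian manifold of constant sectional curvature $K\neq0$, with Levi-Civita connection $\nabla$ (extended complex-linearly). Covariant derivatives of $f$ are defined by $(\nabla f)(Z)=Z f$ and $(\nabla^nf)(Z_1,\dots,Z_n)=(\nabla_{Z_1}(\nabla^{n-1}f))(Z_2,\dots,Z_n)$, i.e. the most recent derivative occupies the first slot. The curvature convention is $R(X,Y)Z=\nabla_X\nabla_YZ-\nabla_Y\nabla_XZ-\nabla_{[X,Y]}Z$. *)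

theory Defs
  imports "HOL-Analysis.Analysis" "HOL-Library.Function_Algebras"
begin

text \<open>
  \<open>Function_Algebras\<close> and \<open>Product_Plus\<close> provide the pointwise additive group structure that is
  used below on tangent vectors, vector fields and complexified vector fields.
\<close>

section \<open>Smooth functions and smooth surfaces\<close>

primrec Ck_on :: "nat \<Rightarrow> 'a::real_normed_vector set \<Rightarrow> ('a \<Rightarrow> 'b::real_normed_vector) \<Rightarrow> bool" where
  "Ck_on 0 S f \<longleftrightarrow> continuous_on S f"
| "Ck_on (Suc k) S f \<longleftrightarrow> (\<forall>x\<in>S. f differentiable (at x)) \<and>
     (\<forall>v. Ck_on k S (\<lambda>x. frechet_derivative f (at x) v))"

text \<open>Only used for open \<open>S\<close>.\<close>

definition smooth_on :: "'a::real_normed_vector set \<Rightarrow> ('a \<Rightarrow> 'b::real_normed_vector) \<Rightarrow> bool" where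
  "smooth_on S f \<longleftrightarrow> (\<forall>k. Ck_on k S f)"

text \<open>
  The manifold \<open>M\<close> is a whole type of class \<open>t2_space\<close> and \<open>second_countable_topology\<close>
  with an atlas of charts into \<open>real ^ 2\<close>.  A chart is a pair \<open>(D, \<phi>)\<close> of its domain and its
  coordinate map; the values of \<open>\<phi>\<close> outside \<open>D\<close> are irrelevant.
\<close>

type_synonym 'm chart = "'m set \<times> ('m \<Rightarrow> real ^ 2)"

definition is_chart :: "'m::topological_space chart \<Rightarrow> bool" where
  "is_chart = (\<lambda>(D, \<phi>). open D \<and> open (\<phi> ` D) \<and> homeomorphism D (\<phi> ` D) \<phi> (inv_into D \<phi>))"

definition smooth_atlas :: "'m::topological_space chart set \<Rightarrow> bool" where
  "smooth_atlas A \<longleftrightarrow> (\<forall>c\<in>A. is_chart c) \<and> (\<Union>(D, \<phi>)\<in>A. D) = UNIV \<and>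
     (\<forall>(D, \<phi>)\<in>A. \<forall>(E, \<psi>)\<in>A. smooth_on (\<phi> ` (D \<inter> E)) (\<psi> \<circ> inv_into D \<phi>))"

text \<open>
  Atlases are not required to be maximal, so orientability asks for an oriented atlas \<open>B\<close> of
  the same smooth structure rather than for a subset of \<open>A\<close>.
\<close>

definition orientable :: "'m::topological_space chart set \<Rightarrow> bool" where
  "orientable A \<longleftrightarrow> (\<exists>B. smooth_atlas B \<and> smooth_atlas (A \<union> B) \<and>
     (\<forall>(D, \<phi>)\<in>B. \<forall>(E, \<psi>)\<in>B. \<forall>x\<in>\<phi> ` (D \<inter> E).
        det (matrix (frechet_derivative (\<psi> \<circ> inv_into D \<phi>) (at x))) > 0))"

definition smooth_fun ::
    "'m::topological_space chart set \<Rightarrow> 'm set \<Rightarrow> ('m \<Rightarrow> 'b::real_normed_vector) \<Rightarrow> bool" where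
  "smooth_fun A U f \<longleftrightarrow> (\<forall>(D, \<phi>)\<in>A. smooth_on (\<phi> ` (D \<inter> U)) (f \<circ> inv_into D \<phi>))"

definition smooth_near ::
    "'m::topological_space chart set \<Rightarrow> 'm \<Rightarrow> ('m \<Rightarrow> 'b::real_normed_vector) \<Rightarrow> bool" where
  "smooth_near A p h \<longleftrightarrow> (\<exists>V. open V \<and> p \<in> V \<and> smooth_fun A V h)"


section \<open>Tangent vectors and vector fields\<close>

text \<open>
  A tangent vector at \<open>p\<close> is a derivation on the germs at \<open>p\<close> of real-valued smooth functions,
  presented as a functional on functions.  The last condition fixes its value on functions
  that are not smooth near \<open>p\<close>, so that equality of tangent vectors is equality in HOL.
\<close>

type_synonym 'm tvec = "('m \<Rightarrow> real) \<Rightarrow> real"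

definition tangent_space :: "'m::topological_space chart set \<Rightarrow> 'm \<Rightarrow> 'm tvec set" where
  "tangent_space A p = {v.
     (\<forall>h k. smooth_near A p h \<and> eventually (\<lambda>q. h q = k q) (nhds p) \<longrightarrow> v h = v k) \<and>
     (\<forall>h k. smooth_near A p h \<and> smooth_near A p k \<longrightarrow> v (\<lambda>q. h q + k q) = v h + v k) \<and>
     (\<forall>a h. smooth_near A p h \<longrightarrow> v (\<lambda>q. a * h q) = a * v h) \<and>
     (\<forall>h k. smooth_near A p h \<and> smooth_near A p k \<longrightarrow>
        v (\<lambda>q. h q * k q) = h p * v k + k p * v h) \<and>
     (\<forall>h. \<not> smooth_near A p h \<longrightarrow> v h = 0)}"

text \<open>
  A smooth real vector field on an open set \<open>U\<close> is extended by \<open>0\<close> outside \<open>U\<close>, again to make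
  equality of fields equality in HOL.
\<close>

type_synonym 'm field = "'m \<Rightarrow> 'm tvec"

definition vector_fields :: "'m::topological_space chart set \<Rightarrow> 'm set \<Rightarrow> 'm field set" where
  "vector_fields A U = {X.
     (\<forall>p\<in>U. X p \<in> tangent_space A p) \<and> (\<forall>p. p \<notin> U \<longrightarrow> X p = 0) \<and>
     (\<forall>V h. open V \<and> V \<subseteq> U \<and> smooth_fun A V h \<longrightarrow> smooth_fun A V (\<lambda>p. X p h))}"

definition restrict_field :: "'m set \<Rightarrow> 'm field \<Rightarrow> 'm field" where
  "restrict_field V X = (\<lambda>p. if p \<in> V then X p else 0)"

definition scale_field :: "('m \<Rightarrow> real) \<Rightarrow> 'm field \<Rightarrow> 'm field" where
  "scale_field f X = (\<lambda>p h. f p * X p h)"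

definition lie_bracket :: "'m::topological_space chart set \<Rightarrow> 'm field \<Rightarrow> 'm field \<Rightarrow> 'm field" where
  "lie_bracket A X Y = (\<lambda>p h. if smooth_near A p h
     then X p (\<lambda>q. Y q h) - Y p (\<lambda>q. X q h) else 0)"


section \<open>Riemannian metrics and completeness\<close>

definition riemannian_metric ::
    "'m::topological_space chart set \<Rightarrow> ('m \<Rightarrow> 'm tvec \<Rightarrow> 'm tvec \<Rightarrow> real) \<Rightarrow> bool" where
  "riemannian_metric A g \<longleftrightarrow>
     (\<forall>p. \<forall>u\<in>tangent_space A p. \<forall>v\<in>tangent_space A p. g p u v = g p v u) \<and>
     (\<forall>p. \<forall>u\<in>tangent_space A p. \<forall>v\<in>tangent_space A p. \<forall>w\<in>tangent_space A p.
        g p (u + v) w = g p u w + g p v w) \<and>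
     (\<forall>p a. \<forall>u\<in>tangent_space A p. \<forall>v\<in>tangent_space A p.
        g p (\<lambda>h. a * u h) v = a * g p u v) \<and>
     (\<forall>p. \<forall>u\<in>tangent_space A p. u \<noteq> 0 \<longrightarrow> g p u u > 0) \<and>
     (\<forall>U. open U \<longrightarrow> (\<forall>X\<in>vector_fields A U. \<forall>Y\<in>vector_fields A U.
        smooth_fun A U (\<lambda>p. g p (X p) (Y p))))"

definition velocity ::
    "'m::topological_space chart set \<Rightarrow> (real \<Rightarrow> 'm) \<Rightarrow> real \<Rightarrow> 'm tvec" where
  "velocity A c t = (\<lambda>h. if smooth_near A (c t) h then vector_derivative (h \<circ> c) (at t) else 0)"

text \<open>
  Curves are parametrised by \<open>[0, 1]\<close>.  The library's piecewise \<open>C\<^sup>1\<close> condition does not bound the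
  velocity at the finitely many exceptional points, so the length is taken in the extended
  nonnegative reals, where a divergent integral yields \<open>\<infinity>\<close>.
\<close>

definition piecewise_C1_curve :: "'m::topological_space chart set \<Rightarrow> (real \<Rightarrow> 'm) \<Rightarrow> bool" where
  "piecewise_C1_curve A c \<longleftrightarrow> continuous_on {0..1} c \<and>
     (\<forall>(D, \<phi>)\<in>A. \<forall>a b. 0 \<le> a \<and> a < b \<and> b \<le> 1 \<and> c ` {a..b} \<subseteq> D \<longrightarrow>
        (\<phi> \<circ> c) piecewise_C1_differentiable_on {a..b})"

definition curve_length ::
    "'m::topological_space chart set \<Rightarrow> ('m \<Rightarrow> 'm tvec \<Rightarrow> 'm tvec \<Rightarrow> real) \<Rightarrow> (real \<Rightarrow> 'm) \<Rightarrow> ennreal" where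
  "curve_length A g c =
     (\<integral>\<^sup>+ t\<in>{0..1}. ennreal (sqrt (g (c t) (velocity A c t) (velocity A c t))) \<partial>lborel)"

definition riemannian_distance ::
    "'m::topological_space chart set \<Rightarrow> ('m \<Rightarrow> 'm tvec \<Rightarrow> 'm tvec \<Rightarrow> real) \<Rightarrow> 'm \<Rightarrow> 'm \<Rightarrow> real" where
  "riemannian_distance A g p q =
     enn2real (INF c\<in>{c. piecewise_C1_curve A c \<and> c 0 = p \<and> c 1 = q}. curve_length A g c)"

definition complete_riemannian ::
    "'m::topological_space chart set \<Rightarrow> ('m \<Rightarrow> 'm tvec \<Rightarrow> 'm tvec \<Rightarrow> real) \<Rightarrow> bool" where
  "complete_riemannian A g \<longleftrightarrow> Metric_space.mcomplete UNIV (riemannian_distance A g)"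


section \<open>The Levi-Civita connection and sectional curvature\<close>

definition affine_connection ::
    "'m::topological_space chart set \<Rightarrow> 'm set \<Rightarrow> ('m field \<Rightarrow> 'm field \<Rightarrow> 'm field) \<Rightarrow> bool" where
  "affine_connection A U D \<longleftrightarrow>
     (\<forall>X\<in>vector_fields A U. \<forall>Y\<in>vector_fields A U. D X Y \<in> vector_fields A U) \<and>
     (\<forall>X\<in>vector_fields A U. \<forall>X'\<in>vector_fields A U. \<forall>Y\<in>vector_fields A U.
        D (X + X') Y = D X Y + D X' Y) \<and>
     (\<forall>f. \<forall>X\<in>vector_fields A U. \<forall>Y\<in>vector_fields A U. smooth_fun A U f \<longrightarrow>
        D (scale_field f X) Y = scale_field f (D X Y)) \<and>
     (\<forall>X\<in>vector_fields A U. \<forall>Y\<in>vector_fields A U. \<forall>Y'\<in>vector_fields A U.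
        D X (Y + Y') = D X Y + D X Y') \<and>
     (\<forall>f. \<forall>X\<in>vector_fields A U. \<forall>Y\<in>vector_fields A U. smooth_fun A U f \<longrightarrow>
        D X (scale_field f Y) = scale_field (\<lambda>p. X p f) Y + scale_field f (D X Y))"

text \<open>
  The connection of \<open>M\<close> acts on vector fields over every open subset: \<open>nabla U X Y\<close> is \<open>\<nabla>\<^sub>X Y\<close> for
  fields \<open>X\<close>, \<open>Y\<close> on \<open>U\<close>, and these operators commute with restriction to smaller open sets.
\<close>

definition levi_civita ::
    "'m::topological_space chart set \<Rightarrow> ('m \<Rightarrow> 'm tvec \<Rightarrow> 'm tvec \<Rightarrow> real) \<Rightarrow>
     ('m set \<Rightarrow> 'm field \<Rightarrow> 'm field \<Rightarrow> 'm field) \<Rightarrow> bool" where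
  "levi_civita A g nabla \<longleftrightarrow>
     (\<forall>U. open U \<longrightarrow> affine_connection A U (nabla U)) \<and>
     (\<forall>U V. open U \<and> open V \<and> V \<subseteq> U \<longrightarrow>
        (\<forall>X\<in>vector_fields A U. \<forall>Y\<in>vector_fields A U.
           restrict_field V (nabla U X Y) = nabla V (restrict_field V X) (restrict_field V Y))) \<and>
     (\<forall>U. open U \<longrightarrow> (\<forall>X\<in>vector_fields A U. \<forall>Y\<in>vector_fields A U.
        nabla U X Y - nabla U Y X = lie_bracket A X Y)) \<and>
     (\<forall>U. open U \<longrightarrow> (\<forall>X\<in>vector_fields A U. \<forall>Y\<in>vector_fields A U. \<forall>Z\<in>vector_fields A U.
        \<forall>p\<in>U. X p (\<lambda>q. g q (Y q) (Z q)) =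
          g p (nabla U X Y p) (Z p) + g p (Y p) (nabla U X Z p)))"

definition curvature ::
    "'m::topological_space chart set \<Rightarrow> ('m field \<Rightarrow> 'm field \<Rightarrow> 'm field) \<Rightarrow>
     'm field \<Rightarrow> 'm field \<Rightarrow> 'm field \<Rightarrow> 'm field" where
  "curvature A D X Y Z = D X (D Y Z) - D Y (D X Z) - D (lie_bracket A X Y) Z"

definition sectional_curvature ::
    "'m::topological_space chart set \<Rightarrow> ('m \<Rightarrow> 'm tvec \<Rightarrow> 'm tvec \<Rightarrow> real) \<Rightarrow>
     ('m field \<Rightarrow> 'm field \<Rightarrow> 'm field) \<Rightarrow> 'm field \<Rightarrow> 'm field \<Rightarrow> 'm \<Rightarrow> real" where
  "sectional_curvature A g D X Y p =
     g p (curvature A D X Y Y p) (X p) /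
       (g p (X p) (X p) * g p (Y p) (Y p) - (g p (X p) (Y p))\<^sup>2)"

definition constant_sectional_curvature ::
    "'m::topological_space chart set \<Rightarrow> ('m \<Rightarrow> 'm tvec \<Rightarrow> 'm tvec \<Rightarrow> real) \<Rightarrow>
     ('m set \<Rightarrow> 'm field \<Rightarrow> 'm field \<Rightarrow> 'm field) \<Rightarrow> real \<Rightarrow> bool" where
  "constant_sectional_curvature A g nabla K \<longleftrightarrow>
     (\<forall>U. open U \<longrightarrow> (\<forall>X\<in>vector_fields A U. \<forall>Y\<in>vector_fields A U. \<forall>p\<in>U.
        (\<forall>a b. (\<forall>h. a * X p h + b * Y p h = 0) \<longrightarrow> a = 0 \<and> b = 0) \<longrightarrow>
        sectional_curvature A g (nabla U) X Y p = K))"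


section \<open>Complexified vector fields and iterated covariant derivatives\<close>

text \<open>
  A complexified vector field is a pair \<open>(X, Y)\<close> of real vector fields, standing for \<open>X + iY\<close>.
  The operators below are the complex-linear extensions of the real ones.
\<close>

type_synonym 'm cfield = "'m field \<times> 'm field"

definition cvector_fields :: "'m::topological_space chart set \<Rightarrow> 'm set \<Rightarrow> 'm cfield set" where
  "cvector_fields A U = vector_fields A U \<times> vector_fields A U"

definition apply_cfield :: "'m cfield \<Rightarrow> ('m \<Rightarrow> complex) \<Rightarrow> 'm \<Rightarrow> complex" where
  "apply_cfield = (\<lambda>(X, Y) f p.
     Complex (X p (\<lambda>q. Re (f q)) - Y p (\<lambda>q. Im (f q)))
             (X p (\<lambda>q. Im (f q)) + Y p (\<lambda>q. Re (f q))))"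

definition complex_ext ::
    "('m field \<Rightarrow> 'm field \<Rightarrow> 'm field) \<Rightarrow> 'm cfield \<Rightarrow> 'm cfield \<Rightarrow> 'm cfield" where
  "complex_ext B = (\<lambda>(X, Y) (V, W). (B X V - B Y W, B X W + B Y V))"

definition ccurvature ::
    "'m::topological_space chart set \<Rightarrow> ('m field \<Rightarrow> 'm field \<Rightarrow> 'm field) \<Rightarrow>
     'm cfield \<Rightarrow> 'm cfield \<Rightarrow> 'm cfield \<Rightarrow> 'm cfield" where
  "ccurvature A D X Y Z =
     complex_ext D X (complex_ext D Y Z) - complex_ext D Y (complex_ext D X Z)
       - complex_ext D (complex_ext (lie_bracket A) X Y) Z"

text \<open>
  A covariant tensor field is a function of the list of its arguments; \<open>cov_deriv D Z T Ws\<close> is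
  \<open>(\<nabla>\<^sub>Z T)(Ws)\<close>, where \<open>Ws ! j\<close> is counted from \<open>j = 0\<close>.
\<close>

definition cov_deriv ::
    "('m field \<Rightarrow> 'm field \<Rightarrow> 'm field) \<Rightarrow> 'm cfield \<Rightarrow>
     ('m cfield list \<Rightarrow> 'm \<Rightarrow> complex) \<Rightarrow> 'm cfield list \<Rightarrow> 'm \<Rightarrow> complex" where
  "cov_deriv D Z T Ws = (\<lambda>p. apply_cfield Z (T Ws) p
     - (\<Sum>j<length Ws. T (Ws[j := complex_ext D Z (Ws ! j)]) p))"

text \<open>
  \<open>nabla_pow D n f [Z\<^sub>1, \<dots>, Z\<^sub>n]\<close> is \<open>(\<nabla>\<^sup>n f)(Z\<^sub>1, \<dots>, Z\<^sub>n)\<close>; with \<open>\<nabla>\<^sup>0 f = f\<close> the first step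
  gives \<open>(\<nabla>f)(Z) = Z f\<close>.
\<close>

primrec nabla_pow ::
    "('m field \<Rightarrow> 'm field \<Rightarrow> 'm field) \<Rightarrow> nat \<Rightarrow> ('m \<Rightarrow> complex) \<Rightarrow>
     'm cfield list \<Rightarrow> 'm \<Rightarrow> complex" where
  "nabla_pow D 0 f = (\<lambda>Zs. f)"
| "nabla_pow D (Suc n) f = (\<lambda>Zs. cov_deriv D (hd Zs) (nabla_pow D n f) (tl Zs))"

end

theory Submission
  imports Defs
begin

text \<open>
  The commutator of two derivatives in adjacent slots is the Ricci identity; covariant derivatives
  taken afterwards commute with it because the curvature is parallel.  For the latter,
  \<open>R(X,Y)Z = K (g(Y,Z) X - g(X,Z) Y)\<close>, tested against a field \<open>W\<close>, is differentiated by metric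
  compatibility.  This formula follows from the curvature symmetries by polarisation once
  \<open>g(R(X,Y)Y,X) = K (g(X,X) g(Y,Y) - g(X,Y)\<^sup>2)\<close> is known for all \<open>X\<close>, \<open>Y\<close> and not only where they are
  independent.  Tensoriality of \<open>R\<close> is not needed for that: at a point of dependence, \<open>Y\<close> is replaced
  by \<open>Y + t B\<close> with a coordinate field \<open>B\<close>; the defect is quadratic in \<open>t\<close> and vanishes for
  \<open>t = 1, -1, 2\<close>, hence for \<open>t = 0\<close>.
\<close>

section \<open>Calculus of \<open>C\<^sup>k\<close> functions\<close>

text \<open>The curvature is an operator on fields over the fixed open set \<open>U\<close>, and
  over \<open>U\<close> no frame need exist: every tangent field on the sphere has a zero. The
  perturbing field therefore lives on a chart domain inside \<open>U\<close>, and the compatibility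
  of \<open>nabla\<close> with restriction carries the result back.

  The correction terms in \<open>cov_deriv\<close> and the right-hand side of the claim have the
  same shape: a map is applied to one argument at a time and the results are added
  (\<open>slot_sum\<close>). Commuting two such operations leaves only the terms in which both maps
  hit the same argument. The Ricci identity and its further derivatives thus reduce to identities
  between \<open>D V\<close> and \<open>R X Y\<close> on single fields, and additivity in each
  argument is the tensor property that enters. This is carried out over abstract abelian groups, so
  that complexification is one instantiation.

  The last two slots carry no curvature term because curvature acts on functions by 0: the Hessian
  of \<open>f\<close> is symmetric.\<close>

lemma Ck_on_SucD:
  assumes "Ck_on (Suc k) S f"
  shows "x \<in> S \<Longrightarrow> (f has_derivative frechet_derivative f (at x)) (at x)"
    and "Ck_on k S (\<lambda>x. frechet_derivative f (at x) v)"
  using assms by (auto simp flip: frechet_derivative_works)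

lemma Ck_on_cong:
  assumes "open S" "Ck_on k S f" "\<And>x. x \<in> S \<Longrightarrow> f x = g x"
  shows "Ck_on k S g"
  using assms(2,3)
proof (induction k arbitrary: f g)
  case 0
  then show ?case using continuous_on_cong by force
next
  case (Suc k)
  have g: "(g has_derivative frechet_derivative f (at x)) (at x)" if "x \<in> S" for x
    using has_derivative_transform_within_open[OF Ck_on_SucD(1)[OF Suc.prems(1)] \<open>open S\<close>]
      Suc.prems(2) that by blast
  then have "frechet_derivative f (at x) = frechet_derivative g (at x)" if "x \<in> S" for x
    using frechet_derivative_at that by blast
  then have "Ck_on k S (\<lambda>x. frechet_derivative g (at x) v)" for v
    using Suc.IH[OF Ck_on_SucD(2)[OF Suc.prems(1), of v]] by simp
  with g show ?case by (auto simp: differentiable_def)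
qed

text \<open>\<open>Ck_on\<close> is phrased with \<open>frechet_derivative\<close>; this lets the
  inductions below supply an explicit derivative, valid only on \<open>S\<close>, with
  \<open>Ck_on_cong\<close> bridging the two.\<close>

lemma Ck_on_SucI:
  assumes "open S" "\<And>x. x \<in> S \<Longrightarrow> (f has_derivative f' x) (at x)"
    and "\<And>v. Ck_on k S (\<lambda>x. f' x v)"
  shows "Ck_on (Suc k) S f"
proof -
  have "f' x = frechet_derivative f (at x)" if "x \<in> S" for x
    using frechet_derivative_at[OF assms(2)[OF that]] .
  then have "Ck_on k S (\<lambda>x. frechet_derivative f (at x) v)" for v
    using Ck_on_cong[OF assms(1,3), of v] by simp
  then show ?thesis
    using assms(2) by (auto simp: differentiable_def)
qed

lemma Ck_on_subset: "Ck_on k S f \<Longrightarrow> T \<subseteq> S \<Longrightarrow> Ck_on k T f"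
  by (induction k arbitrary: f) (auto intro: continuous_on_subset)

lemma Ck_on_continuous: "open S \<Longrightarrow> Ck_on k S f \<Longrightarrow> continuous_on S f"
  by (cases k) (auto intro!: continuous_at_imp_continuous_on differentiable_imp_continuous_within)

lemma Ck_on_less: "open S \<Longrightarrow> Ck_on (Suc k) S f \<Longrightarrow> Ck_on k S f"
proof (induction k arbitrary: f)
  case 0
  then show ?case using Ck_on_continuous by (simp del: Ck_on.simps(2)) blast
next
  case (Suc k)
  show ?case
    using Suc.prems(1) Ck_on_SucD[OF Suc.prems(2)] Suc.IH
    by (intro Ck_on_SucI[of S f "\<lambda>x. frechet_derivative f (at x)"]) (auto simp del: Ck_on.simps(2))
qed

lemma Ck_on_bounded_linear:
  assumes "open S" "bounded_linear L" "Ck_on k S f"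
  shows "Ck_on k S (\<lambda>x. L (f x))"
  using assms(3)
proof (induction k arbitrary: f)
  case 0
  then show ?case
    using bounded_linear.continuous_on[OF assms(2)] by simp
next
  case (Suc k)
  show ?case
    using Ck_on_SucD[OF Suc.prems] Suc.IH
    by (intro Ck_on_SucI[OF assms(1), of _ "\<lambda>x v. L (frechet_derivative f (at x) v)"]
        bounded_linear.has_derivative[OF assms(2)]) auto
qed

lemma Ck_on_const: "open S \<Longrightarrow> Ck_on k S (\<lambda>_. c)"
  by (induction k arbitrary: c) (auto intro!: Ck_on_SucI[of S _ "\<lambda>_ _. 0"] simp del: Ck_on.simps(2))

lemma Ck_on_add:
  assumes "open S" "Ck_on k S f" "Ck_on k S g"
  shows "Ck_on k S (\<lambda>x. f x + g x)"
  using assms(2,3)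
proof (induction k arbitrary: f g)
  case 0
  then show ?case by (simp add: continuous_on_add)
next
  case (Suc k)
  show ?case
    using Ck_on_SucD[OF Suc.prems(1)] Ck_on_SucD[OF Suc.prems(2)] Suc.IH
    by (intro Ck_on_SucI[OF assms(1),
          of _ "\<lambda>x v. frechet_derivative f (at x) v + frechet_derivative g (at x) v"]
        has_derivative_add) auto
qed

text \<open>The product rule leaves undifferentiated factors in the derivative, so the step also
  uses \<open>f\<close> and \<open>g\<close> at the lower order \<open>k\<close>, from
  \<open>Ck_on_less\<close>.\<close>

lemma Ck_on_mult:
  fixes f g :: "'a::real_normed_vector \<Rightarrow> real"
  assumes "open S" "Ck_on k S f" "Ck_on k S g"
  shows "Ck_on k S (\<lambda>x. f x * g x)"
  using assms(2,3)
proof (induction k arbitrary: f g)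
  case 0
  then show ?case by (simp add: continuous_on_mult)
next
  case (Suc k)
  show ?case
    using Ck_on_SucD[OF Suc.prems(1)] Ck_on_SucD[OF Suc.prems(2)] Suc.IH
      Ck_on_less[OF assms(1) Suc.prems(1)] Ck_on_less[OF assms(1) Suc.prems(2)]
    by (intro Ck_on_SucI[OF assms(1), of _ "\<lambda>x v. f x * frechet_derivative g (at x) v
            + frechet_derivative f (at x) v * g x"]
        has_derivative_mult Ck_on_add[OF assms(1)]) auto
qed

lemma Ck_on_sum:
  "open S \<Longrightarrow> (\<And>i. i \<in> I \<Longrightarrow> Ck_on k S (f i)) \<Longrightarrow> Ck_on k S (\<lambda>x. \<Sum>i\<in>I. f i x)"
  by (induction I rule: infinite_finite_induct) (auto intro!: Ck_on_const Ck_on_add)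

text \<open>In the chain rule the direction in which \<open>f\<close> is differentiated varies with
  \<open>x\<close>, whereas \<open>Ck_on\<close> controls derivatives in fixed directions. Expanding
  the direction in \<open>Basis\<close> separates the two dependences; \<open>f\<close> is
  generalised because its partial derivatives take its place while \<open>g\<close> stays.\<close>

lemma Ck_on_compose:
  fixes g :: "'a::real_normed_vector \<Rightarrow> 'b::euclidean_space" and f :: "'b \<Rightarrow> real"
  assumes "open S" "open T" "g ` S \<subseteq> T" "Ck_on k S g" "Ck_on k T f"
  shows "Ck_on k S (\<lambda>x. f (g x))"
  using assms(4,5)
proof (induction k arbitrary: f)
  case 0
  then show ?case
    using assms(3) by (auto intro: continuous_on_compose2)
next
  case (Suc k)
  let ?h = "\<lambda>x v. \<Sum>i\<in>Basis. (frechet_derivative g (at x) v \<bullet> i) * frechet_derivative f (at (g x)) i"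
  show ?case
  proof (rule Ck_on_SucI[OF assms(1), of _ ?h])
    fix x assume x: "x \<in> S"
    have f: "(f has_derivative frechet_derivative f (at (g x))) (at (g x))"
      using Ck_on_SucD(1)[OF Suc.prems(2)] x assms(3) by blast
    have "(f \<circ> g has_derivative (frechet_derivative f (at (g x)) \<circ> frechet_derivative g (at x))) (at x)"
      using diff_chain_at[OF Ck_on_SucD(1)[OF Suc.prems(1) x] f] .
    moreover have "frechet_derivative f (at (g x)) w
        = (\<Sum>i\<in>Basis. (w \<bullet> i) * frechet_derivative f (at (g x)) i)" for w
    proof -
      have "frechet_derivative f (at (g x)) w
          = frechet_derivative f (at (g x)) (\<Sum>i\<in>Basis. (w \<bullet> i) *\<^sub>R i)"
        by (simp only: euclidean_representation)
      also have "\<dots> = (\<Sum>i\<in>Basis. (w \<bullet> i) * frechet_derivative f (at (g x)) i)"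
        by (simp add: linear_sum[OF has_derivative_linear[OF f]]
            linear_cmul[OF has_derivative_linear[OF f]])
      finally show ?thesis .
    qed
    ultimately have "frechet_derivative f (at (g x)) \<circ> frechet_derivative g (at x) = ?h x"
      and "(f \<circ> g has_derivative (frechet_derivative f (at (g x)) \<circ> frechet_derivative g (at x))) (at x)"
      unfolding o_def by blast+
    then show "((\<lambda>x. f (g x)) has_derivative ?h x) (at x)"
      unfolding o_def by simp
  next
    fix v
    show "Ck_on k S (\<lambda>x. ?h x v)"
      using Ck_on_SucD(2)[OF Suc.prems(1)] Ck_on_SucD(2)[OF Suc.prems(2)]
        Ck_on_less[OF assms(1) Suc.prems(1)]
      by (intro Ck_on_sum Ck_on_mult Suc.IH assms Ck_on_bounded_linear[OF _ bounded_linear_inner_left]) auto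
  qed
qed

section \<open>Smooth functions, tangent vectors and vector fields on a manifold\<close>

lemma smooth_on_cong: "open S \<Longrightarrow> smooth_on S f \<Longrightarrow> (\<And>x. x \<in> S \<Longrightarrow> f x = g x) \<Longrightarrow> smooth_on S g"
  unfolding smooth_on_def using Ck_on_cong by blast

lemma smooth_on_subset: "smooth_on S f \<Longrightarrow> T \<subseteq> S \<Longrightarrow> smooth_on T f"
  unfolding smooth_on_def using Ck_on_subset by blast

lemma smooth_on_bounded_linear: "open S \<Longrightarrow> bounded_linear L \<Longrightarrow> smooth_on S f \<Longrightarrow> smooth_on S (L \<circ> f)"
  unfolding smooth_on_def o_def using Ck_on_bounded_linear by blast

lemma smooth_on_has_derivative:
  "smooth_on S f \<Longrightarrow> x \<in> S \<Longrightarrow> (f has_derivative frechet_derivative f (at x)) (at x)"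
  unfolding smooth_on_def using Ck_on_SucD(1) by blast

lemma smooth_on_frechet_derivative: "smooth_on S f \<Longrightarrow> smooth_on S (\<lambda>x. frechet_derivative f (at x) v)"
  unfolding smooth_on_def using Ck_on_SucD(2) by blast

lemma smooth_on_compose:
  fixes g :: "'a::real_normed_vector \<Rightarrow> 'b::euclidean_space" and f :: "'b \<Rightarrow> real"
  assumes "open S" "open T" "g ` S \<subseteq> T" "smooth_on S g" "smooth_on T f"
  shows "smooth_on S (f \<circ> g)"
  using assms Ck_on_compose unfolding smooth_on_def o_def by blast

locale smooth_manifold =
  fixes A :: "'m::topological_space chart set"
  assumes atlas: "smooth_atlas A"
begin

lemma chart:
  assumes "(D, \<phi>) \<in> A"
  shows chart_open: "open D" and chart_inj: "inj_on \<phi> D"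
    and chart_open_image: "open V \<Longrightarrow> open (\<phi> ` (D \<inter> V))"
proof -
  have "is_chart (D, \<phi>)"
    using atlas assms by (auto simp: smooth_atlas_def)
  then have D: "open D" "open (\<phi> ` D)" and hom: "homeomorphism D (\<phi> ` D) \<phi> (inv_into D \<phi>)"
    by (auto simp: is_chart_def)
  show "open D" by fact
  show "inj_on \<phi> D"
    using hom by (auto simp: homeomorphism_def intro: inj_on_inverseI)
  assume "open V"
  then have "openin (top_of_set (\<phi> ` D)) (\<phi> ` (D \<inter> V))"
    by (intro homeomorphism_imp_open_map[OF hom] openin_open_Int)
  then show "open (\<phi> ` (D \<inter> V))"
    by (rule openin_open_trans) fact
qed

lemma chart_inv: "(D, \<phi>) \<in> A \<Longrightarrow> q \<in> D \<Longrightarrow> inv_into D \<phi> (\<phi> q) = q"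
  using chart_inj inv_into_f_f by metis

lemma chart_cover: obtains D \<phi> where "(D, \<phi>) \<in> A" "p \<in> D"
  using atlas unfolding smooth_atlas_def by fast

lemma smooth_funI:
  "(\<And>D \<phi>. (D, \<phi>) \<in> A \<Longrightarrow> smooth_on (\<phi> ` (D \<inter> U)) (f \<circ> inv_into D \<phi>)) \<Longrightarrow> smooth_fun A U f"
  by (auto simp: smooth_fun_def)

lemma smooth_funD:
  "smooth_fun A U f \<Longrightarrow> (D, \<phi>) \<in> A \<Longrightarrow> smooth_on (\<phi> ` (D \<inter> U)) (f \<circ> inv_into D \<phi>)"
  by (auto simp: smooth_fun_def)

lemma smooth_fun_cong:
  assumes "open U" "smooth_fun A U f" "\<And>q. q \<in> U \<Longrightarrow> f q = k q"
  shows "smooth_fun A U k"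
proof (rule smooth_funI)
  fix D \<phi> assume c: "(D, \<phi>) \<in> A"
  show "smooth_on (\<phi> ` (D \<inter> U)) (k \<circ> inv_into D \<phi>)"
    using chart_inv[OF c] assms(3)
    by (intro smooth_on_cong[OF chart_open_image[OF c assms(1)] smooth_funD[OF assms(2) c]]) auto
qed

lemma smooth_fun_subset: "smooth_fun A U f \<Longrightarrow> V \<subseteq> U \<Longrightarrow> smooth_fun A V f"
  by (rule smooth_funI, rule smooth_on_subset, erule (1) smooth_funD, blast)

lemma smooth_fun_bounded_linear:
  assumes "open U" "bounded_linear L" "smooth_fun A U f"
  shows "smooth_fun A U (\<lambda>q. L (f q))"
proof (rule smooth_funI)
  fix D \<phi> assume c: "(D, \<phi>) \<in> A"
  show "smooth_on (\<phi> ` (D \<inter> U)) ((\<lambda>q. L (f q)) \<circ> inv_into D \<phi>)"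
    using smooth_on_bounded_linear[OF chart_open_image[OF c assms(1)] assms(2) smooth_funD[OF assms(3) c]]
    by (simp add: o_def)
qed

lemma smooth_fun_const: "open U \<Longrightarrow> smooth_fun A U (\<lambda>_. c)"
  by (rule smooth_funI) (simp add: smooth_on_def o_def Ck_on_const chart_open_image)

lemma smooth_fun_add:
  assumes "open U" "smooth_fun A U f" "smooth_fun A U k"
  shows "smooth_fun A U (\<lambda>q. f q + k q)"
proof (rule smooth_funI)
  fix D \<phi> assume c: "(D, \<phi>) \<in> A"
  show "smooth_on (\<phi> ` (D \<inter> U)) ((\<lambda>q. f q + k q) \<circ> inv_into D \<phi>)"
    using smooth_funD[OF assms(2) c] smooth_funD[OF assms(3) c]
    by (simp add: smooth_on_def o_def Ck_on_add[OF chart_open_image[OF c assms(1)]])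
qed

lemma smooth_fun_mult:
  fixes f k :: "'m \<Rightarrow> real"
  assumes "open U" "smooth_fun A U f" "smooth_fun A U k"
  shows "smooth_fun A U (\<lambda>q. f q * k q)"
proof (rule smooth_funI)
  fix D \<phi> assume c: "(D, \<phi>) \<in> A"
  show "smooth_on (\<phi> ` (D \<inter> U)) ((\<lambda>q. f q * k q) \<circ> inv_into D \<phi>)"
    using smooth_funD[OF assms(2) c] smooth_funD[OF assms(3) c]
    by (simp add: smooth_on_def o_def Ck_on_mult[OF chart_open_image[OF c assms(1)]])
qed

lemma smooth_fun_minus: "open U \<Longrightarrow> smooth_fun A U f \<Longrightarrow> smooth_fun A U (\<lambda>q. - f q)"
  using smooth_fun_bounded_linear[OF _ bounded_linear_minus[OF bounded_linear_ident]] by blast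

lemma smooth_fun_diff:
  "open U \<Longrightarrow> smooth_fun A U f \<Longrightarrow> smooth_fun A U k \<Longrightarrow> smooth_fun A U (\<lambda>q. f q - k q)"
  using smooth_fun_add[of U f "\<lambda>q. - k q"] smooth_fun_minus by force

lemma smooth_nearI: "open V \<Longrightarrow> p \<in> V \<Longrightarrow> smooth_fun A V h \<Longrightarrow> smooth_near A p h"
  by (auto simp: smooth_near_def)

lemma smooth_nearE:
  assumes "smooth_near A p h" "open U" "p \<in> U"
  obtains V where "open V" "p \<in> V" "V \<subseteq> U" "smooth_fun A V h"
proof -
  obtain V where "open V" "p \<in> V" "smooth_fun A V h"
    using assms(1) by (auto simp: smooth_near_def)
  with assms that[of "V \<inter> U"] show thesis
    using smooth_fun_subset by blast
qed

lemma smooth_near_cong: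
  assumes "smooth_near A p h" "eventually (\<lambda>q. h q = k q) (nhds p)"
  shows "smooth_near A p k"
proof -
  obtain W where "open W" "p \<in> W" "\<And>q. q \<in> W \<Longrightarrow> h q = k q"
    using assms(2) by (auto simp: eventually_nhds)
  with smooth_nearE[OF assms(1)] show ?thesis
    by (metis smooth_fun_cong smooth_nearI subsetD)
qed

lemma smooth_near_combine:
  assumes "smooth_near A p h" "smooth_near A p k"
  obtains V where "open V" "p \<in> V" "smooth_fun A V h" "smooth_fun A V k"
proof -
  obtain W where "open W" "p \<in> W" "smooth_fun A W k"
    using assms(2) by (auto simp: smooth_near_def)
  with smooth_nearE[OF assms(1)] that show thesis
    using smooth_fun_subset by metis
qed

lemma smooth_near_add: "smooth_near A p h \<Longrightarrow> smooth_near A p k \<Longrightarrow> smooth_near A p (\<lambda>q. h q + k q)"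
  by (erule (1) smooth_near_combine) (rule smooth_nearI, assumption+, rule smooth_fun_add)

lemma smooth_near_mult:
  fixes h k :: "'m \<Rightarrow> real"
  shows "smooth_near A p h \<Longrightarrow> smooth_near A p k \<Longrightarrow> smooth_near A p (\<lambda>q. h q * k q)"
  by (erule (1) smooth_near_combine) (rule smooth_nearI, assumption+, rule smooth_fun_mult)

lemma smooth_near_minus: "smooth_near A p h \<Longrightarrow> smooth_near A p (\<lambda>q. - h q)"
  by (metis smooth_near_def smooth_fun_minus)

section \<open>Tangent vectors as derivations on germs, and fields of them\<close>

lemma tangent_cong:
  "v \<in> tangent_space A p \<Longrightarrow> smooth_near A p h \<Longrightarrow> eventually (\<lambda>q. h q = k q) (nhds p) \<Longrightarrow> v h = v k"
  unfolding tangent_space_def by blast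

lemma tangent_cong_open:
  "v \<in> tangent_space A p \<Longrightarrow> smooth_near A p h \<Longrightarrow> open U \<Longrightarrow> p \<in> U \<Longrightarrow> (\<And>q. q \<in> U \<Longrightarrow> h q = k q) \<Longrightarrow> v h = v k"
  using tangent_cong[of v p h k] unfolding eventually_nhds by blast

lemma tangent_add:
  "v \<in> tangent_space A p \<Longrightarrow> smooth_near A p h \<Longrightarrow> smooth_near A p k \<Longrightarrow> v (\<lambda>q. h q + k q) = v h + v k"
  by (simp add: tangent_space_def)

lemma tangent_scale: "v \<in> tangent_space A p \<Longrightarrow> smooth_near A p h \<Longrightarrow> v (\<lambda>q. a * h q) = a * v h"
  by (simp add: tangent_space_def)

lemma tangent_mult:
  "v \<in> tangent_space A p \<Longrightarrow> smooth_near A p h \<Longrightarrow> smooth_near A p k \<Longrightarrow> v (\<lambda>q. h q * k q) = h p * v k + k p * v h"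
  by (simp add: tangent_space_def)

lemma tangent_not_smooth: "v \<in> tangent_space A p \<Longrightarrow> \<not> smooth_near A p h \<Longrightarrow> v h = 0"
  by (simp add: tangent_space_def)

lemma tangent_minus: "v \<in> tangent_space A p \<Longrightarrow> smooth_near A p h \<Longrightarrow> v (\<lambda>q. - h q) = - v h"
  using tangent_scale[of v p h "-1"] by simp

lemma tangent_diff:
  "v \<in> tangent_space A p \<Longrightarrow> smooth_near A p h \<Longrightarrow> smooth_near A p k \<Longrightarrow> v (\<lambda>q. h q - k q) = v h - v k"
  using tangent_add[of v p h "\<lambda>q. - k q"] tangent_minus[of v p k] smooth_near_minus[of p k] by simp

lemma tangent_spaceI:
  assumes "\<And>h k. smooth_near A p h \<Longrightarrow> eventually (\<lambda>q. h q = k q) (nhds p) \<Longrightarrow> v h = v k"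
    and "\<And>h k. smooth_near A p h \<Longrightarrow> smooth_near A p k \<Longrightarrow> v (\<lambda>q. h q + k q) = v h + v k"
    and "\<And>h k. smooth_near A p h \<Longrightarrow> smooth_near A p k \<Longrightarrow> v (\<lambda>q. h q * k q) = h p * v k + k p * v h"
    and "\<And>a h. smooth_near A p h \<Longrightarrow> v (\<lambda>q. a * h q) = a * v h"
    and "\<And>h. \<not> smooth_near A p h \<Longrightarrow> v h = 0"
  shows "v \<in> tangent_space A p"
  unfolding tangent_space_def mem_Collect_eq
  by (intro conjI allI impI, (elim conjE, rule assms(1), assumption+),
      (elim conjE, rule assms(2), assumption+), (rule assms(4), assumption),
      (elim conjE, rule assms(3), assumption+), (rule assms(5), assumption))

lemma tangent_space_add:
  assumes v: "v \<in> tangent_space A p" and w: "w \<in> tangent_space A p"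
  shows "v + w \<in> tangent_space A p"
proof (rule tangent_spaceI)
  fix h k :: "'m \<Rightarrow> real" assume "smooth_near A p h" "eventually (\<lambda>q. h q = k q) (nhds p)"
  then show "(v + w) h = (v + w) k"
    using tangent_cong[OF v, of h k] tangent_cong[OF w, of h k] by simp
qed (simp_all add: tangent_add[OF v] tangent_add[OF w] tangent_scale[OF v] tangent_scale[OF w]
    tangent_mult[OF v] tangent_mult[OF w] tangent_not_smooth[OF v] tangent_not_smooth[OF w] algebra_simps)

lemma tangent_space_minus:
  assumes v: "v \<in> tangent_space A p"
  shows "- v \<in> tangent_space A p"
proof (rule tangent_spaceI)
  fix h k :: "'m \<Rightarrow> real" assume "smooth_near A p h" "eventually (\<lambda>q. h q = k q) (nhds p)"
  then show "(- v) h = (- v) k"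
    using tangent_cong[OF v, of h k] by simp
qed (simp_all add: tangent_add[OF v] tangent_scale[OF v] tangent_mult[OF v] tangent_not_smooth[OF v])

lemma tangent_space_diff:
  "v \<in> tangent_space A p \<Longrightarrow> w \<in> tangent_space A p \<Longrightarrow> v - w \<in> tangent_space A p"
  using tangent_space_add[of v p "- w"] tangent_space_minus[of w p] by simp

lemma zero_tangent_space: "0 \<in> tangent_space A p"
  by (simp add: tangent_space_def)

text \<open>Valid at every point: outside \<open>U\<close> the value is 0, which is a tangent
  vector. This is why purely algebraic facts such as \<open>defect_add2\<close> carry no condition
  on \<open>p\<close>.\<close>

lemma vector_fields_tangent: "X \<in> vector_fields A U \<Longrightarrow> X p \<in> tangent_space A p"
  unfolding vector_fields_def using zero_tangent_space by (cases "p \<in> U") auto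

lemma vector_fields_outside: "X \<in> vector_fields A U \<Longrightarrow> p \<notin> U \<Longrightarrow> X p = 0"
  unfolding vector_fields_def by blast

lemma vector_fields_smooth:
  "X \<in> vector_fields A U \<Longrightarrow> open V \<Longrightarrow> V \<subseteq> U \<Longrightarrow> smooth_fun A V h \<Longrightarrow> smooth_fun A V (\<lambda>p. X p h)"
  unfolding vector_fields_def by blast

lemma vector_fieldsI:
  assumes "\<And>p. p \<in> U \<Longrightarrow> X p \<in> tangent_space A p" "\<And>p. p \<notin> U \<Longrightarrow> X p = 0"
    and "\<And>V h. open V \<Longrightarrow> V \<subseteq> U \<Longrightarrow> smooth_fun A V h \<Longrightarrow> smooth_fun A V (\<lambda>p. X p h)"
  shows "X \<in> vector_fields A U"
  unfolding vector_fields_def using assms by blast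

lemma vector_fields_add:
  "X \<in> vector_fields A U \<Longrightarrow> Y \<in> vector_fields A U \<Longrightarrow> X + Y \<in> vector_fields A U"
  by (rule vector_fieldsI)
    (auto simp: vector_fields_tangent tangent_space_add vector_fields_outside vector_fields_smooth smooth_fun_add)

lemma vector_fields_minus: "X \<in> vector_fields A U \<Longrightarrow> - X \<in> vector_fields A U"
  by (rule vector_fieldsI)
    (auto simp: vector_fields_tangent tangent_space_minus vector_fields_outside vector_fields_smooth smooth_fun_minus)

lemma vector_fields_diff:
  "X \<in> vector_fields A U \<Longrightarrow> Y \<in> vector_fields A U \<Longrightarrow> X - Y \<in> vector_fields A U"
  using vector_fields_add[of X U "- Y"] vector_fields_minus by simp

lemma restrict_field_vector_fields:
  assumes "X \<in> vector_fields A U" "open V" "V \<subseteq> U"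
  shows "restrict_field V X \<in> vector_fields A V"
proof (rule vector_fieldsI)
  fix W and h :: "'m \<Rightarrow> real" assume W: "open W" "W \<subseteq> V" "smooth_fun A W h"
  then have "smooth_fun A W (\<lambda>p. X p h)"
    using assms vector_fields_smooth by blast
  then show "smooth_fun A W (\<lambda>p. restrict_field V X p h)"
    using W by (elim smooth_fun_cong[rotated]) (auto simp: restrict_field_def)
qed (use assms vector_fields_tangent in \<open>auto simp: restrict_field_def\<close>)

lemma restrict_field_diff: "restrict_field V (X - Y) = restrict_field V X - restrict_field V Y"
  by (auto simp: restrict_field_def fun_eq_iff)

lemma lie_bracket_apply:
  "open V \<Longrightarrow> p \<in> V \<Longrightarrow> smooth_fun A V h \<Longrightarrow>
    lie_bracket A X Y p h = X p (\<lambda>q. Y q h) - Y p (\<lambda>q. X q h)"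
  using smooth_nearI by (auto simp: lie_bracket_def)

section \<open>Coordinate fields and local frames\<close>

definition chart_field :: "'m set \<Rightarrow> ('m \<Rightarrow> real ^ 2) \<Rightarrow> real ^ 2 \<Rightarrow> 'm field" where
  "chart_field D \<phi> e p h = (if p \<in> D \<and> smooth_near A p h
     then frechet_derivative (h \<circ> inv_into D \<phi>) (at (\<phi> p)) e else 0)"

lemma smooth_near_chart_derivative:
  assumes "(D, \<phi>) \<in> A" "p \<in> D" "smooth_near A p h"
  shows "(h \<circ> inv_into D \<phi> has_derivative frechet_derivative (h \<circ> inv_into D \<phi>) (at (\<phi> p))) (at (\<phi> p))"
proof -
  obtain V where V: "p \<in> V" "smooth_fun A V h"
    using assms(3) by (auto simp: smooth_near_def)
  then show ?thesis
    using smooth_on_has_derivative[OF smooth_funD[OF V(2) assms(1)]] assms(2) by blast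
qed

lemma chart_field_eqI:
  assumes "(D, \<phi>) \<in> A" "p \<in> D" "smooth_near A p h"
    and "(h \<circ> inv_into D \<phi> has_derivative h') (at (\<phi> p))"
  shows "chart_field D \<phi> e p h = h' e"
  using frechet_derivative_at[OF assms(4)] assms(2,3) by (simp add: chart_field_def)

text \<open>On germs this is a directional derivative in the chart, so the derivation laws are rules
  for Frechet derivatives; the default 0 for functions that are not smooth near \<open>p\<close>
  matches the last condition of \<open>tangent_space\<close>.\<close>

lemma chart_field_tangent:
  assumes c: "(D, \<phi>) \<in> A" and p: "p \<in> D"
  shows "chart_field D \<phi> e p \<in> tangent_space A p"
proof -
  let ?v = "chart_field D \<phi> e p"
  let ?d = "\<lambda>h. frechet_derivative (h \<circ> inv_into D \<phi>) (at (\<phi> p))"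
  note deriv = smooth_near_chart_derivative[OF c p]
  have v: "?v h = ?d h e" if "smooth_near A p h" for h
    using that p by (simp add: chart_field_def)
  have "?v h = ?v k" if h: "smooth_near A p h" and ev: "eventually (\<lambda>q. h q = k q) (nhds p)" for h k :: "'m \<Rightarrow> real"
  proof -
    obtain W where W: "open W" "p \<in> W" "\<And>q. q \<in> W \<Longrightarrow> h q = k q"
      using ev by (auto simp: eventually_nhds)
    have "(k \<circ> inv_into D \<phi> has_derivative ?d h) (at (\<phi> p))"
      using W p chart_inv[OF c]
      by (intro has_derivative_transform_within_open[OF deriv[OF h] chart_open_image[OF c W(1)]]) auto
    then show ?thesis
      using chart_field_eqI[OF c p smooth_near_cong[OF h ev]] v[OF h] by simp
  qed
  moreover have "?v (\<lambda>q. h q + k q) = ?v h + ?v k"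
    if "smooth_near A p h" "smooth_near A p k" for h k :: "'m \<Rightarrow> real"
  proof -
    have "((\<lambda>q. h q + k q) \<circ> inv_into D \<phi> has_derivative (\<lambda>e. ?d h e + ?d k e)) (at (\<phi> p))"
      using has_derivative_add[OF deriv[OF that(1)] deriv[OF that(2)]] by (simp add: o_def)
    then show ?thesis
      using chart_field_eqI[OF c p smooth_near_add[OF that]] v[OF that(1)] v[OF that(2)] by simp
  qed
  moreover have "?v (\<lambda>q. h q * k q) = h p * ?v k + k p * ?v h"
    if "smooth_near A p h" "smooth_near A p k" for h k :: "'m \<Rightarrow> real"
  proof -
    have "((\<lambda>q. h q * k q) \<circ> inv_into D \<phi> has_derivative (\<lambda>e. h p * ?d k e + ?d h e * k p)) (at (\<phi> p))"
      using has_derivative_mult[OF deriv[OF that(1)] deriv[OF that(2)]] chart_inv[OF c p]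
      by (simp add: o_def)
    then show ?thesis
      using chart_field_eqI[OF c p smooth_near_mult[OF that]] v[OF that(1)] v[OF that(2)] by simp
  qed
  moreover have "?v (\<lambda>q. a * h q) = a * ?v h" if "smooth_near A p h" for a and h :: "'m \<Rightarrow> real"
  proof -
    have "smooth_near A p (\<lambda>q. a * h q)"
      using smooth_near_mult[OF smooth_nearI[OF open_UNIV UNIV_I smooth_fun_const[OF open_UNIV]] that] .
    moreover have "((\<lambda>q. a * h q) \<circ> inv_into D \<phi> has_derivative (\<lambda>e. a * ?d h e)) (at (\<phi> p))"
      using has_derivative_mult_right[OF deriv[OF that], of a] by (simp add: o_def)
    ultimately show ?thesis
      using chart_field_eqI[OF c p] v[OF that] by simp
  qed
  moreover have "?v h = 0" if "\<not> smooth_near A p h" for h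
    using that by (simp add: chart_field_def)
  ultimately show ?thesis
    by (rule tangent_spaceI)
qed

text \<open>Smoothness must be seen in every chart \<open>\<psi>\<close>, not only in
  \<open>\<phi>\<close>: there the coordinate derivative is a function of the
  \<open>\<phi>\<close>-coordinates composed with the transition map, to which
  \<open>smooth_on_compose\<close> applies.\<close>

lemma chart_field_vector_fields:
  assumes c: "(D, \<phi>) \<in> A"
  shows "chart_field D \<phi> e \<in> vector_fields A D"
proof (rule vector_fieldsI)
  fix V and h :: "'m \<Rightarrow> real" assume V: "open V" "V \<subseteq> D" "smooth_fun A V h"
  show "smooth_fun A V (\<lambda>p. chart_field D \<phi> e p h)"
  proof (rule smooth_funI)
    fix E \<psi> assume c': "(E, \<psi>) \<in> A"
    let ?F = "\<lambda>x. frechet_derivative (h \<circ> inv_into D \<phi>) (at x) e" and ?G = "\<phi> \<circ> inv_into E \<psi>"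
    have "smooth_on (\<psi> ` (E \<inter> D)) ?G"
      using atlas c c' unfolding smooth_atlas_def by fast
    then have "smooth_on (\<psi> ` (E \<inter> V)) ?G"
      using V(2) by (elim smooth_on_subset) auto
    moreover have "smooth_on (\<phi> ` (D \<inter> V)) ?F"
      by (rule smooth_on_frechet_derivative[OF smooth_funD[OF V(3) c]])
    moreover have "?G ` \<psi> ` (E \<inter> V) \<subseteq> \<phi> ` (D \<inter> V)"
      using V(2) chart_inv[OF c'] by (auto simp: o_def)
    ultimately have "smooth_on (\<psi> ` (E \<inter> V)) (?F \<circ> ?G)"
      using chart_open_image[OF c V(1)] chart_open_image[OF c' V(1)] smooth_on_compose by blast
    then show "smooth_on (\<psi> ` (E \<inter> V)) ((\<lambda>p. chart_field D \<phi> e p h) \<circ> inv_into E \<psi>)"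
      using V chart_inv[OF c'] smooth_nearI[OF V(1) _ V(3)]
      by (elim smooth_on_cong[OF chart_open_image[OF c' V(1)]]) (auto simp: chart_field_def)
  qed
qed (use chart_field_tangent[OF c] in \<open>auto simp: chart_field_def fun_eq_iff\<close>)

text \<open>The premise of \<open>constant_sectional_curvature\<close> word for word, so that the
  hypothesis applies after unfolding.\<close>

definition independent_vectors :: "'m tvec \<Rightarrow> 'm tvec \<Rightarrow> bool" where
  "independent_vectors u v \<longleftrightarrow> (\<forall>a b. (\<forall>h. a * u h + b * v h = 0) \<longrightarrow> a = 0 \<and> b = 0)"

lemma chart_fields_independent:
  assumes c: "(D, \<phi>) \<in> A" and p: "p \<in> D"
  shows "independent_vectors (chart_field D \<phi> (axis 1 1) p) (chart_field D \<phi> (axis 2 1) p)"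
  unfolding independent_vectors_def
proof (intro allI impI)
  fix a b assume eq: "\<forall>h. a * chart_field D \<phi> (axis 1 1) p h + b * chart_field D \<phi> (axis 2 1) p h = 0"
  \<comment> \<open>The coordinate functions read off the components of the direction
    \<open>e\<close>, which separates the two coefficients.\<close>
  have val: "chart_field D \<phi> e p (\<lambda>q. \<phi> q $ i) = e $ i" for e i
  proof (rule chart_field_eqI[OF c p])
    show "smooth_near A p (\<lambda>q. \<phi> q $ i)"
    proof (rule smooth_nearI[OF chart_open[OF c] p], rule smooth_funI)
      fix E \<psi> assume c': "(E, \<psi>) \<in> A"
      have "smooth_on (\<psi> ` (E \<inter> D)) (\<phi> \<circ> inv_into E \<psi>)"
        using atlas c c' unfolding smooth_atlas_def by fast
      then show "smooth_on (\<psi> ` (E \<inter> D)) ((\<lambda>q. \<phi> q $ i) \<circ> inv_into E \<psi>)"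
        using smooth_on_bounded_linear[OF chart_open_image[OF c' chart_open[OF c]] bounded_linear_vec_nth]
        by (fastforce simp: o_def)
    qed
    show "((\<lambda>q. \<phi> q $ i) \<circ> inv_into D \<phi> has_derivative (\<lambda>e. e $ i)) (at (\<phi> p))"
      using p chart_inv[OF c]
      by (intro has_derivative_transform_within_open[OF
            bounded_linear_imp_has_derivative[OF bounded_linear_vec_nth]
            chart_open_image[OF c open_UNIV]]) auto
  qed
  show "a = 0 \<and> b = 0"
    using eq[rule_format, of "\<lambda>q. \<phi> q $ 1"] eq[rule_format, of "\<lambda>q. \<phi> q $ 2"]
    by (simp add: val axis_def)
qed

lemma local_frame:
  assumes "open U" "p \<in> U"
  obtains V X Y where "open V" "p \<in> V" "V \<subseteq> U" "X \<in> vector_fields A V" "Y \<in> vector_fields A V"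
    "independent_vectors (X p) (Y p)"
proof -
  obtain D \<phi> where c: "(D, \<phi>) \<in> A" and p: "p \<in> D"
    by (rule chart_cover)
  show thesis
    using assms p chart_open[OF c] chart_fields_independent[OF c p]
    by (intro that[of "D \<inter> U" "restrict_field (D \<inter> U) (chart_field D \<phi> (axis 1 1))"
          "restrict_field (D \<inter> U) (chart_field D \<phi> (axis 2 1))"]
        restrict_field_vector_fields[OF chart_field_vector_fields[OF c]])
      (auto simp: restrict_field_def)
qed

end

section \<open>Parallel curvature in constant sectional curvature\<close>

lemma curvature_like_pair_symmetric:
  fixes G :: "'v \<Rightarrow> 'v \<Rightarrow> 'v \<Rightarrow> 'v \<Rightarrow> real"
  assumes swap12: "\<And>X Y Z W. X \<in> F \<Longrightarrow> Y \<in> F \<Longrightarrow> Z \<in> F \<Longrightarrow> W \<in> F \<Longrightarrow> G Y X Z W = - G X Y Z W"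
    and swap34: "\<And>X Y Z W. X \<in> F \<Longrightarrow> Y \<in> F \<Longrightarrow> Z \<in> F \<Longrightarrow> W \<in> F \<Longrightarrow> G X Y W Z = - G X Y Z W"
    and bianchi: "\<And>X Y Z W. X \<in> F \<Longrightarrow> Y \<in> F \<Longrightarrow> Z \<in> F \<Longrightarrow> W \<in> F \<Longrightarrow>
      G X Y Z W + G Y Z X W + G Z X Y W = 0"
    and F: "X \<in> F" "Y \<in> F" "Z \<in> F" "W \<in> F"
  shows "G X Y Z W = G Z W X Y"
  \<comment> \<open>Bianchi at the four cyclic rotations of the arguments: after the antisymmetries,
    the first two minus the last two leave twice the difference of the two sides.\<close>
  using bianchi[OF F(1,2,3,4)] bianchi[OF F(2,3,4,1)] bianchi[OF F(3,4,1,2)] bianchi[OF F(4,1,2,3)]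
    swap34[OF F(2,3,4,1)] swap34[OF F(3,1,4,2)] swap34[OF F(3,4,2,1)] swap34[OF F(4,2,3,1)]
    swap34[OF F(4,1,2,3)] swap34[OF F(1,2,4,3)]
    swap12[OF F(1,3,4,2)] swap12[OF F(2,4,3,1)] swap12[OF F(1,3,2,4)] swap12[OF F(2,4,1,3)]
    swap34[OF F(1,3,2,4)] swap34[OF F(2,4,1,3)]
  by linarith

text \<open>An algebraic curvature tensor is determined by its biquadratic form
  \<open>G X Y Y X\<close>: polarising first in the inner and then in the outer pair yields
  antisymmetry in slots 1 and 4. Only sums of arguments occur, and \<open>F\<close> is a set rather
  than a type, so that \<open>G\<close> may act on the fields over \<open>U\<close>.\<close>

lemma curvature_like_eq_0:
  fixes G :: "'v::plus \<Rightarrow> 'v \<Rightarrow> 'v \<Rightarrow> 'v \<Rightarrow> real"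
  assumes add_mem: "\<And>X Y. X \<in> F \<Longrightarrow> Y \<in> F \<Longrightarrow> X + Y \<in> F"
    and add2: "\<And>X Y Y' Z W. X \<in> F \<Longrightarrow> Y \<in> F \<Longrightarrow> Y' \<in> F \<Longrightarrow> Z \<in> F \<Longrightarrow> W \<in> F \<Longrightarrow>
      G X (Y + Y') Z W = G X Y Z W + G X Y' Z W"
    and add3: "\<And>X Y Z Z' W. X \<in> F \<Longrightarrow> Y \<in> F \<Longrightarrow> Z \<in> F \<Longrightarrow> Z' \<in> F \<Longrightarrow> W \<in> F \<Longrightarrow>
      G X Y (Z + Z') W = G X Y Z W + G X Y Z' W"
    and swap12: "\<And>X Y Z W. X \<in> F \<Longrightarrow> Y \<in> F \<Longrightarrow> Z \<in> F \<Longrightarrow> W \<in> F \<Longrightarrow> G Y X Z W = - G X Y Z W"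
    and swap34: "\<And>X Y Z W. X \<in> F \<Longrightarrow> Y \<in> F \<Longrightarrow> Z \<in> F \<Longrightarrow> W \<in> F \<Longrightarrow> G X Y W Z = - G X Y Z W"
    and bianchi: "\<And>X Y Z W. X \<in> F \<Longrightarrow> Y \<in> F \<Longrightarrow> Z \<in> F \<Longrightarrow> W \<in> F \<Longrightarrow>
      G X Y Z W + G Y Z X W + G Z X Y W = 0"
    and diag: "\<And>X Y. X \<in> F \<Longrightarrow> Y \<in> F \<Longrightarrow> G X Y Y X = 0"
    and F: "X \<in> F" "Y \<in> F" "Z \<in> F" "W \<in> F"
  shows "G X Y Z W = 0"
proof -
  have pair: "G X Y Z W = G Z W X Y" if m: "X \<in> F" "Y \<in> F" "Z \<in> F" "W \<in> F" for X Y Z W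
    by (rule curvature_like_pair_symmetric[of F G])
      ((rule swap12; assumption) | (rule swap34; assumption) | (rule bianchi; assumption) | rule m)+
  have outer: "G X Y Z X = 0" if m: "X \<in> F" "Y \<in> F" "Z \<in> F" for X Y Z
  proof -
    \<comment> \<open>The two cross terms agree by pair symmetry, so each of them vanishes.\<close>
    have "G X (Y + Z) (Y + Z) X = G X Y Y X + G X Y Z X + G X Z Y X + G X Z Z X"
      using m add_mem by (simp add: add2 add3)
    then show ?thesis
      using diag[OF m(1) add_mem[OF m(2,3)]] diag[OF m(1,2)] diag[OF m(1,3)] pair[OF m(1,3,2,1)]
        swap12[OF m(1,2,1,3)] swap34[OF m(1,2,3,1)] by linarith
  qed
  have add1: "G (X + X') Y Z W = G X Y Z W + G X' Y Z W"
    if "X \<in> F" "X' \<in> F" "Y \<in> F" "Z \<in> F" "W \<in> F" for X X' Y Z W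
    using that swap12[of "X + X'" Y Z W] swap12[of X Y Z W] swap12[of X' Y Z W] add2[of Y X X' Z W] add_mem
    by simp
  have add4: "G X Y Z (W + W') = G X Y Z W + G X Y Z W'"
    if "X \<in> F" "W' \<in> F" "Y \<in> F" "Z \<in> F" "W \<in> F" for X W' Y Z W
    using that swap34[of X Y "W + W'" Z] swap34[of X Y W Z] swap34[of X Y W' Z] add3[of X Y W W' Z] add_mem
    by simp
  have swap14: "G W Y Z X = - G X Y Z W" if m: "X \<in> F" "Y \<in> F" "Z \<in> F" "W \<in> F" for X Y Z W
  proof -
    have "G (X + W) Y Z (X + W) = G X Y Z X + G X Y Z W + G W Y Z X + G W Y Z W"
      using m add_mem by (simp add: add1 add4)
    then show ?thesis
      using outer[OF add_mem[OF m(1,4)] m(2,3)] outer[OF m(1,2,3)] outer[OF m(4,2,3)] by linarith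
  qed
  \<comment> \<open>\<open>swap14\<close> with pair symmetry and \<open>swap34\<close> makes
    \<open>G\<close> invariant under rotating the first three arguments, so Bianchi reads
    \<open>3 * G X Y Z W = 0\<close>.\<close>
  show ?thesis
    using bianchi[OF F] swap14[OF F(2,3,1,4)] pair[OF F(4,3,1,2)] swap34[OF F]
      swap14[OF F(3,1,2,4)] pair[OF F(4,1,2,3)] swap34[OF F(2,3,1,4)] by linarith
qed

context smooth_manifold
begin

lemma dependent_vectorsE:
  assumes "\<not> independent_vectors u v" "u \<noteq> 0"
  obtains c where "v = (\<lambda>h. c * u h)"
proof -
  obtain a b where ab: "\<And>h. a * u h + b * v h = 0" "a \<noteq> 0 \<or> b \<noteq> 0"
    using assms(1) by (auto simp: independent_vectors_def)
  have "b \<noteq> 0"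
    using ab assms(2) by (auto simp: fun_eq_iff)
  then have "v h = (- a / b) * u h" for h
    using ab(1)[of h] by (simp add: field_simps eq_neg_iff_add_eq_0)
  then show thesis
    using that by blast
qed

text \<open>Meant for a point where \<open>Y\<close> equals \<open>c\<close> times \<open>X\<close>:
  there \<open>v\<close> is the value of \<open>Y + t B\<close>, and the coefficient matrix has
  determinant \<open>t\<close>.\<close>

lemma independent_vectors_shear:
  assumes "independent_vectors u w" "t \<noteq> 0" "\<And>h. v h = c * u h + t * w h"
  shows "independent_vectors u v"
  unfolding independent_vectors_def
proof (intro allI impI)
  fix a b assume "\<forall>h. a * u h + b * v h = 0"
  then have "\<forall>h. (a + b * c) * u h + (b * t) * w h = 0"
    by (simp add: assms(3) algebra_simps)
  then have "a + b * c = 0 \<and> b * t = 0"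
    using assms(1) unfolding independent_vectors_def by blast
  then show "a = 0 \<and> b = 0"
    using assms(2) by auto
qed

lemma independent_vectors_exchange:
  assumes "independent_vectors v w" "u \<noteq> 0"
  shows "independent_vectors u v \<or> independent_vectors u w"
proof (rule ccontr)
  assume "\<not> ?thesis"
  then obtain c d where cd: "v = (\<lambda>h. c * u h)" "w = (\<lambda>h. d * u h)"
    using dependent_vectorsE[OF _ assms(2)] by metis
  have "\<forall>h. d * v h + (- c) * w h = 0"
    by (simp add: cd)
  then have "d = 0 \<and> - c = 0"
    using assms(1) unfolding independent_vectors_def by blast
  then have "\<forall>h. 1 * v h + 0 * w h = 0"
    by (simp add: cd)
  then show False
    using assms(1) unfolding independent_vectors_def by (metis zero_neq_one)
qed

end

text \<open>\<open>U\<close> is a parameter so that the locale can be interpreted again over a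
  smaller open set \<open>V\<close>; this is how a question at one point is moved into a
  chart.\<close>

locale space_form_open = smooth_manifold A for A :: "'m::topological_space chart set" +
  fixes g :: "'m \<Rightarrow> 'm tvec \<Rightarrow> 'm tvec \<Rightarrow> real"
    and nabla :: "'m set \<Rightarrow> 'm field \<Rightarrow> 'm field \<Rightarrow> 'm field"
    and K :: real
    and U :: "'m set"
  assumes metric: "riemannian_metric A g"
    and levi_civita: "levi_civita A g nabla"
    and sectional: "constant_sectional_curvature A g nabla K"
    and K_nonzero: "K \<noteq> 0"
    and open_U: "open U"
begin

abbreviation "F \<equiv> vector_fields A U"
abbreviation "D \<equiv> nabla U"
abbreviation "lb \<equiv> lie_bracket A"
abbreviation "R \<equiv> curvature A (nabla U)"

lemma field_tangent: "X \<in> F \<Longrightarrow> X p \<in> tangent_space A p"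
  by (rule vector_fields_tangent)

lemma g_sym: "u \<in> tangent_space A p \<Longrightarrow> v \<in> tangent_space A p \<Longrightarrow> g p u v = g p v u"
  by (rule metric[unfolded riemannian_metric_def, THEN conjunct1, rule_format])

lemma g_add_left:
  "u \<in> tangent_space A p \<Longrightarrow> v \<in> tangent_space A p \<Longrightarrow> w \<in> tangent_space A p \<Longrightarrow>
    g p (u + v) w = g p u w + g p v w"
  by (rule metric[unfolded riemannian_metric_def, THEN conjunct2, THEN conjunct1, rule_format])

lemma g_pos: "u \<in> tangent_space A p \<Longrightarrow> u \<noteq> 0 \<Longrightarrow> g p u u > 0"
  by (rule metric[unfolded riemannian_metric_def, THEN conjunct2, THEN conjunct2, THEN conjunct2, THEN conjunct1, rule_format])

lemma g_smooth: "X \<in> F \<Longrightarrow> Y \<in> F \<Longrightarrow> smooth_fun A U (\<lambda>p. g p (X p) (Y p))"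
  by (rule metric[unfolded riemannian_metric_def, THEN conjunct2, THEN conjunct2, THEN conjunct2, THEN conjunct2, rule_format, OF open_U])

lemma g_smooth_near: "X \<in> F \<Longrightarrow> Y \<in> F \<Longrightarrow> p \<in> U \<Longrightarrow> smooth_near A p (\<lambda>p. g p (X p) (Y p))"
  using g_smooth smooth_nearI[OF open_U] by blast

lemma g_add_right: "u \<in> tangent_space A p \<Longrightarrow> v \<in> tangent_space A p \<Longrightarrow> w \<in> tangent_space A p \<Longrightarrow>
    g p w (u + v) = g p w u + g p w v"
  using g_add_left[of u p v w] g_sym[of w p] tangent_space_add[of u p v] by simp

lemma g_minus_left: "u \<in> tangent_space A p \<Longrightarrow> w \<in> tangent_space A p \<Longrightarrow> g p (- u) w = - g p u w"
  using g_add_left[of u p "- u" w] g_add_left[of 0 p 0 w] tangent_space_minus[of u p] zero_tangent_space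
  by simp

lemma g_diff_left: "u \<in> tangent_space A p \<Longrightarrow> v \<in> tangent_space A p \<Longrightarrow> w \<in> tangent_space A p \<Longrightarrow>
    g p (u - v) w = g p u w - g p v w"
  using g_add_left[of u p "- v" w] g_minus_left[of v p w] tangent_space_minus[of v p] by simp

lemma g_diff_right: "u \<in> tangent_space A p \<Longrightarrow> v \<in> tangent_space A p \<Longrightarrow> w \<in> tangent_space A p \<Longrightarrow>
    g p w (u - v) = g p w u - g p w v"
  using g_diff_left[of u p v w] g_sym[of w p] tangent_space_add[of u p "- v"] tangent_space_minus[of v p]
  by simp

lemma connection: "affine_connection A U D"
  by (rule levi_civita[unfolded levi_civita_def, THEN conjunct1, rule_format, OF open_U])

lemma D_F: "X \<in> F \<Longrightarrow> Y \<in> F \<Longrightarrow> D X Y \<in> F"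
  by (rule connection[unfolded affine_connection_def, THEN conjunct1, rule_format])

lemma D_add_left: "X \<in> F \<Longrightarrow> X' \<in> F \<Longrightarrow> Y \<in> F \<Longrightarrow> D (X + X') Y = D X Y + D X' Y"
  by (rule connection[unfolded affine_connection_def, THEN conjunct2, THEN conjunct1, rule_format])

lemma D_add_right: "X \<in> F \<Longrightarrow> Y \<in> F \<Longrightarrow> Y' \<in> F \<Longrightarrow> D X (Y + Y') = D X Y + D X Y'"
  by (rule connection[unfolded affine_connection_def, THEN conjunct2, THEN conjunct2, THEN conjunct2, THEN conjunct1, rule_format])

lemma D_diff_left: "X \<in> F \<Longrightarrow> X' \<in> F \<Longrightarrow> Y \<in> F \<Longrightarrow> D (X - X') Y = D X Y - D X' Y"
  using D_add_left[of "X - X'" X' Y] vector_fields_diff[of X U X'] by simp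

lemma D_diff_right: "X \<in> F \<Longrightarrow> Y \<in> F \<Longrightarrow> Y' \<in> F \<Longrightarrow> D X (Y - Y') = D X Y - D X Y'"
  using D_add_right[of X "Y - Y'" Y'] vector_fields_diff[of Y U Y'] by simp

lemma lb_eq: "X \<in> F \<Longrightarrow> Y \<in> F \<Longrightarrow> lb X Y = D X Y - D Y X"
  by (rule levi_civita[unfolded levi_civita_def, THEN conjunct2, THEN conjunct2, THEN conjunct1, rule_format, OF open_U, symmetric])

lemma lb_F: "X \<in> F \<Longrightarrow> Y \<in> F \<Longrightarrow> lb X Y \<in> F"
  by (simp add: lb_eq D_F vector_fields_diff)

lemma compatible: "X \<in> F \<Longrightarrow> Y \<in> F \<Longrightarrow> Z \<in> F \<Longrightarrow> p \<in> U \<Longrightarrow>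
    X p (\<lambda>q. g q (Y q) (Z q)) = g p (D X Y p) (Z p) + g p (Y p) (D X Z p)"
  by (rule levi_civita[unfolded levi_civita_def, THEN conjunct2, THEN conjunct2, THEN conjunct2, rule_format, OF open_U])

section \<open>Symmetries of the curvature\<close>

lemma R_eq: "X \<in> F \<Longrightarrow> Y \<in> F \<Longrightarrow> R X Y Z = D X (D Y Z) - D Y (D X Z) - D (D X Y - D Y X) Z"
  by (simp add: curvature_def lb_eq)

lemma R_F: "X \<in> F \<Longrightarrow> Y \<in> F \<Longrightarrow> Z \<in> F \<Longrightarrow> R X Y Z \<in> F"
  by (simp add: R_eq D_F vector_fields_diff)

text \<open>Once \<open>R_eq\<close> has replaced the bracket by \<open>D X Y - D Y X\<close>,
  additivity is inherited from the connection.\<close>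

lemma R_add1: "X \<in> F \<Longrightarrow> X' \<in> F \<Longrightarrow> Y \<in> F \<Longrightarrow> Z \<in> F \<Longrightarrow> R (X + X') Y Z = R X Y Z + R X' Y Z"
  and R_add2: "X \<in> F \<Longrightarrow> X' \<in> F \<Longrightarrow> Y \<in> F \<Longrightarrow> Z \<in> F \<Longrightarrow> R Y (X + X') Z = R Y X Z + R Y X' Z"
  and R_add3: "X \<in> F \<Longrightarrow> X' \<in> F \<Longrightarrow> Y \<in> F \<Longrightarrow> Z \<in> F \<Longrightarrow> R Y Z (X + X') = R Y Z X + R Y Z X'"
  by (simp_all add: R_eq D_F vector_fields_add vector_fields_diff D_add_left D_add_right
      D_diff_left D_diff_right algebra_simps)

lemma R_swap: "X \<in> F \<Longrightarrow> Y \<in> F \<Longrightarrow> Z \<in> F \<Longrightarrow> R Y X Z = - R X Y Z"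
  by (simp add: R_eq D_F D_diff_left)

lemma compatible2:
  assumes "X \<in> F" "Y \<in> F" "Z \<in> F" "W \<in> F" "p \<in> U"
  shows "X p (\<lambda>q. Y q (\<lambda>r. g r (Z r) (W r))) = g p (D X (D Y Z) p) (W p) + g p (D Y Z p) (D X W p)
    + g p (D X Z p) (D Y W p) + g p (Z p) (D X (D Y W) p)"
proof -
  let ?h = "\<lambda>q. g q (D Y Z q) (W q)" and ?k = "\<lambda>q. g q (Z q) (D Y W q)"
  have near: "smooth_near A p ?h" "smooth_near A p ?k"
    using assms D_F g_smooth_near by blast+
  have "X p (\<lambda>q. Y q (\<lambda>r. g r (Z r) (W r))) = X p (\<lambda>q. ?h q + ?k q)"
    using compatible[OF assms(2,3,4)] assms(5)
    by (intro tangent_cong_open[OF field_tangent[OF assms(1)] smooth_near_add[OF near] open_U, symmetric]) auto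
  also have "\<dots> = X p ?h + X p ?k"
    by (rule tangent_add[OF field_tangent[OF assms(1)] near])
  finally show ?thesis
    using assms D_F by (simp add: compatible)
qed

text \<open>The operator \<open>XY - YX - [X,Y]\<close> annihilates the function
  \<open>g(Z,W)\<close>; in its expansion by \<open>compatible2\<close> the two mixed terms are
  symmetric in \<open>X\<close> and \<open>Y\<close> and cancel.\<close>

lemma R_swap34:
  assumes "X \<in> F" "Y \<in> F" "Z \<in> F" "W \<in> F" "p \<in> U"
  shows "g p (R X Y W p) (Z p) = - g p (R X Y Z p) (W p)"
proof -
  have "lb X Y p (\<lambda>q. g q (Z q) (W q))
      = X p (\<lambda>q. Y q (\<lambda>r. g r (Z r) (W r))) - Y p (\<lambda>q. X q (\<lambda>r. g r (Z r) (W r)))"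
    using assms by (intro lie_bracket_apply[OF open_U] g_smooth)
  then have "g p (R X Y Z p) (W p) + g p (Z p) (R X Y W p) = 0"
    using assms by (simp add: compatible compatible2 lb_F curvature_def D_F field_tangent tangent_space_diff
        g_diff_left g_diff_right)
  then show ?thesis
    using g_sym[of "Z p" p "R X Y W p"] assms R_F field_tangent by simp
qed

text \<open>A function \<open>h\<close> may be smooth only near \<open>p\<close>, so the inner
  bracket is computed on a neighbourhood \<open>V\<close>; \<open>X p\<close> depends on nothing
  beyond it.\<close>

lemma lb_lb_apply:
  assumes "X \<in> F" "Y \<in> F" "Z \<in> F" "open V" "V \<subseteq> U" "p \<in> V" "smooth_fun A V h"
  shows "lb X (lb Y Z) p h = X p (\<lambda>q. Y q (\<lambda>r. Z r h)) - X p (\<lambda>q. Z q (\<lambda>r. Y r h))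
    - Y p (\<lambda>q. Z q (\<lambda>r. X r h)) + Z p (\<lambda>q. Y q (\<lambda>r. X r h))"
proof -
  have sm: "smooth_fun A V (\<lambda>q. B q k)" if "B \<in> F" "smooth_fun A V k" for B k
    using vector_fields_smooth[OF that(1) assms(4,5) that(2)] .
  have near: "smooth_near A p (\<lambda>q. Y q (\<lambda>r. Z r h))" "smooth_near A p (\<lambda>q. Z q (\<lambda>r. Y r h))"
    using assms sm smooth_nearI by blast+
  have "X p (\<lambda>q. lb Y Z q h) = X p (\<lambda>q. Y q (\<lambda>r. Z r h) - Z q (\<lambda>r. Y r h))"
    using lie_bracket_apply[OF assms(4) _ assms(7)] sm[OF lb_F[OF assms(2,3)] assms(7)] smooth_nearI assms
    by (intro tangent_cong_open[OF field_tangent[OF assms(1)] _ assms(4,6)]) auto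
  also have "\<dots> = X p (\<lambda>q. Y q (\<lambda>r. Z r h)) - X p (\<lambda>q. Z q (\<lambda>r. Y r h))"
    by (rule tangent_diff[OF field_tangent[OF assms(1)] near])
  finally show ?thesis
    using lie_bracket_apply[OF assms(4,6,7), of X "lb Y Z"]
      lie_bracket_apply[OF assms(4,6) sm[OF assms(1,7)], of Y Z] by simp
qed

lemma Jacobi:
  assumes "X \<in> F" "Y \<in> F" "Z \<in> F"
  shows "lb X (lb Y Z) + lb Y (lb Z X) + lb Z (lb X Y) = 0"
proof (intro ext)
  fix p h
  have F: "lb X (lb Y Z) \<in> F" "lb Y (lb Z X) \<in> F" "lb Z (lb X Y) \<in> F"
    using assms lb_F by auto
  show "(lb X (lb Y Z) + lb Y (lb Z X) + lb Z (lb X Y)) p h = (0 :: 'm field) p h"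
  proof (cases "p \<in> U \<and> smooth_near A p h")
    case True
    then obtain V where V: "open V" "p \<in> V" "V \<subseteq> U" "smooth_fun A V h"
      using smooth_nearE open_U by metis
    show ?thesis
      using lb_lb_apply[OF _ _ _ V(1,3,2,4)] assms by simp
  next
    \<comment> \<open>Both sides take the default value 0: off \<open>U\<close> the fields vanish,
      and tangent vectors kill functions that are not smooth near \<open>p\<close>.\<close>
    case False
    then show ?thesis
      using F[THEN vector_fields_outside] F[THEN field_tangent, THEN tangent_not_smooth]
      by (cases "p \<in> U") auto
  qed
qed

lemma R_bianchi:
  assumes "X \<in> F" "Y \<in> F" "Z \<in> F"
  shows "R X Y Z + R Y Z X + R Z X Y = 0"
proof -
  \<comment> \<open>Torsion-freeness for \<open>Z\<close> and \<open>[X,Y]\<close> turns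
    \<open>D [X,Y] Z\<close> into \<open>D Z [X,Y]\<close> minus \<open>[Z,[X,Y]]\<close>. In the
    cyclic sum the second derivatives then cancel and the Jacobi sum remains.\<close>
  have alt: "R X Y Z = D X (D Y Z) - D Y (D X Z) - D Z (D X Y) + D Z (D Y X) + lb Z (lb X Y)"
    if "X \<in> F" "Y \<in> F" "Z \<in> F" for X Y Z
    using that by (simp add: curvature_def lb_eq[of Z "lb X Y"] lb_F) (simp add: lb_eq D_diff_right D_F)
  have "R X Y Z + R Y Z X + R Z X Y = lb X (lb Y Z) + lb Y (lb Z X) + lb Z (lb X Y)"
    unfolding alt[OF assms] alt[OF assms(2,3,1)] alt[OF assms(3,1,2)] by (simp add: algebra_simps)
  then show ?thesis
    using Jacobi[OF assms] by simp
qed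

text \<open>The curvature minus the model tensor of constant curvature \<open>K\<close>. The
  arguments are fields and not vectors at \<open>p\<close>, because \<open>R\<close> differentiates
  them; in this form \<open>curvature_like_eq_0\<close> applies with \<open>F\<close> the fields
  over \<open>U\<close>.\<close>

definition defect :: "'m \<Rightarrow> 'm field \<Rightarrow> 'm field \<Rightarrow> 'm field \<Rightarrow> 'm field \<Rightarrow> real" where
  "defect p X Y Z W = g p (R X Y Z p) (W p)
     - K * (g p (Y p) (Z p) * g p (X p) (W p) - g p (X p) (Z p) * g p (Y p) (W p))"

lemma defect_add2: "X \<in> F \<Longrightarrow> Y \<in> F \<Longrightarrow> Y' \<in> F \<Longrightarrow> Z \<in> F \<Longrightarrow> W \<in> F \<Longrightarrow>
    defect p X (Y + Y') Z W = defect p X Y Z W + defect p X Y' Z W"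
  by (simp add: defect_def R_add2 R_F field_tangent g_add_left algebra_simps)

lemma defect_add3: "X \<in> F \<Longrightarrow> Y \<in> F \<Longrightarrow> Z \<in> F \<Longrightarrow> Z' \<in> F \<Longrightarrow> W \<in> F \<Longrightarrow>
    defect p X Y (Z + Z') W = defect p X Y Z W + defect p X Y Z' W"
  by (simp add: defect_def R_add3 R_F field_tangent g_add_left g_add_right algebra_simps)

lemma defect_swap12: "X \<in> F \<Longrightarrow> Y \<in> F \<Longrightarrow> Z \<in> F \<Longrightarrow> W \<in> F \<Longrightarrow>
    defect p Y X Z W = - defect p X Y Z W"
  by (simp add: defect_def R_swap[of X Y Z] g_minus_left R_F field_tangent algebra_simps)

lemma defect_swap34: "X \<in> F \<Longrightarrow> Y \<in> F \<Longrightarrow> Z \<in> F \<Longrightarrow> W \<in> F \<Longrightarrow> p \<in> U \<Longrightarrow>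
    defect p X Y W Z = - defect p X Y Z W"
  by (simp add: defect_def R_swap34[of X Y Z W] algebra_simps)

lemma defect_bianchi:
  assumes "X \<in> F" "Y \<in> F" "Z \<in> F" "W \<in> F"
  shows "defect p X Y Z W + defect p Y Z X W + defect p Z X Y W = 0"
proof -
  have "g p ((R X Y Z + R Y Z X + R Z X Y) p) (W p) = 0"
    unfolding R_bianchi[OF assms(1-3)] using g_diff_left[of 0 p 0 "W p"] assms field_tangent zero_tangent_space
    by simp
  then have "g p (R X Y Z p) (W p) + g p (R Y Z X p) (W p) + g p (R Z X Y p) (W p) = 0"
    using assms by (simp add: g_add_left R_F field_tangent tangent_space_add)
  then show ?thesis
    using assms g_sym[of "Z p" p "X p"] g_sym[of "Z p" p "Y p"] g_sym[of "Y p" p "X p"]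
    by (simp add: defect_def field_tangent algebra_simps)
qed

text \<open>Since \<open>K \<noteq> 0\<close>, the denominator of the sectional curvature cannot take the junk value \<open>0\<close>.\<close>

lemma defect_independent:
  assumes "X \<in> F" "Y \<in> F" "p \<in> U" "independent_vectors (X p) (Y p)"
  shows "defect p X Y Y X = 0"
proof -
  have "g p (R X Y Y p) (X p) / (g p (X p) (X p) * g p (Y p) (Y p) - (g p (X p) (Y p))\<^sup>2) = K"
    using sectional assms open_U
    unfolding constant_sectional_curvature_def independent_vectors_def sectional_curvature_def by metis
  then have "g p (R X Y Y p) (X p) = K * (g p (X p) (X p) * g p (Y p) (Y p) - (g p (X p) (Y p))\<^sup>2)"
    using K_nonzero by (auto simp: field_simps)
  then show ?thesis
    using g_sym[of "Y p" p "X p"] assms by (simp add: defect_def field_tangent power2_eq_square algebra_simps)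
qed

text \<open>With \<open>q(t)\<close> the value at \<open>Y + t B\<close>, a polynomial of degree at
  most 2, one has \<open>q(0) = q(1) + (q(-1) - q(2)) / 3\<close>. The case \<open>t = 2\<close> is
  written \<open>Y + B + B\<close> so that additivity alone reaches it.\<close>

lemma defect_quadratic:
  assumes F: "X \<in> F" "Y \<in> F" "B \<in> F"
    and zero: "defect p X (Y + B) (Y + B) X = 0" "defect p X (Y - B) (Y - B) X = 0"
      "defect p X (Y + B + B) (Y + B + B) X = 0"
  shows "defect p X Y Y X = 0"
proof -
  have sub: "Y - B \<in> F" and add: "Y + B \<in> F"
    using F vector_fields_diff vector_fields_add by auto
  have sq: "defect p X (S + T) (S + T) X = defect p X S S X + (defect p X S T X + defect p X T S X) + defect p X T T X"
    if "S \<in> F" "T \<in> F" for S T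
    using that F vector_fields_add by (simp add: defect_add2 defect_add3)
  have lin: "defect p X (S + B) B X = defect p X S B X + defect p X B B X"
    "defect p X B (S + B) X = defect p X B S X + defect p X B B X" if "S \<in> F" for S
    using that F by (simp_all add: defect_add2 defect_add3)
  \<comment> \<open>\<open>sq\<close> is used for \<open>Y + B\<close>, for \<open>Y\<close> written
    as \<open>(Y - B) + B\<close>, and for \<open>(Y + B) + B\<close>.\<close>
  show ?thesis
    using zero sq[OF F(2,3)] sq[OF sub F(3)] sq[OF add F(3)] lin[OF F(2)] lin[OF sub] by simp
qed

lemma defect_diagonal_frame:
  assumes F: "X \<in> F" "Y \<in> F" and p: "p \<in> U"
    and E: "E1 \<in> F" "E2 \<in> F" "independent_vectors (E1 p) (E2 p)"
  shows "defect p X Y Y X = 0"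
proof -
  have nz: "defect p X Y Y X = 0" if F: "X \<in> F" "Y \<in> F" and "X p \<noteq> 0" for X Y
  proof (cases "independent_vectors (X p) (Y p)")
    case True
    then show ?thesis using defect_independent F p by blast
  next
    case False
    then obtain c where c: "Y p = (\<lambda>h. c * X p h)"
      using dependent_vectorsE \<open>X p \<noteq> 0\<close> by metis
    \<comment> \<open>Two independent frame vectors cannot both be multiples of the nonzero vector
      \<open>X p\<close>.\<close>
    obtain B where B: "B \<in> F" "independent_vectors (X p) (B p)"
      using independent_vectors_exchange[OF E(3) \<open>X p \<noteq> 0\<close>] E by blast
    note shear = independent_vectors_shear[OF B(2), where c = c]
    have indep: "independent_vectors (X p) ((Y + B) p)" "independent_vectors (X p) ((Y - B) p)"
      "independent_vectors (X p) ((Y + B + B) p)"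
      using shear[of 1 "(Y + B) p"] shear[of "-1" "(Y - B) p"] shear[of 2 "(Y + B + B) p"]
      by (simp_all add: c)
    show ?thesis
      by (intro defect_quadratic[OF F B(1)] defect_independent vector_fields_add vector_fields_diff F B p indep)
  qed
  have flip: "defect p X Y Y X = defect p Y X X Y" if "X \<in> F" "Y \<in> F" for X Y
    using that p defect_swap12[of Y X Y X p] defect_swap34[of Y X X Y p] by simp
  show ?thesis
  proof (cases "X p = 0")
    \<comment> \<open>Where \<open>X p\<close> vanishes no choice of \<open>Y\<close> gives
      independence, so \<open>X\<close> is perturbed instead: \<open>flip\<close> moves it to the
      repeated slots, and \<open>X + t E1\<close> is nonzero at \<open>p\<close> for each
      \<open>t\<close> that \<open>defect_quadratic\<close> asks for.\<close>
    case True
    have E1: "E1 p \<noteq> 0"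
      using E(3) unfolding independent_vectors_def by (auto dest: spec[of _ 1])
    then obtain h where h: "E1 p h \<noteq> 0" by (auto simp: fun_eq_iff)
    have "(X + E1) p h \<noteq> 0" "(X - E1) p h \<noteq> 0" "(X + E1 + E1) p h \<noteq> 0"
      using h True by auto
    then have "(X + E1) p \<noteq> 0" "(X - E1) p \<noteq> 0" "(X + E1 + E1) p \<noteq> 0"
      by (metis zero_fun_apply)+
    then have "defect p Y (X + E1) (X + E1) Y = 0" "defect p Y (X - E1) (X - E1) Y = 0"
      "defect p Y (X + E1 + E1) (X + E1 + E1) Y = 0"
      using F E vector_fields_add vector_fields_diff nz flip by metis+
    then show ?thesis
      using defect_quadratic[OF F(2,1) E(1)] flip[OF F] by simp
  qed (use nz F in blast)
qed

lemma nabla_restrict: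
  assumes "open V" "V \<subseteq> U" "X \<in> F" "Y \<in> F"
  shows "restrict_field V (nabla U X Y) = nabla V (restrict_field V X) (restrict_field V Y)"
  by (rule levi_civita[unfolded levi_civita_def, THEN conjunct2, THEN conjunct1, rule_format]) (use open_U assms in simp_all)

lemma curvature_restrict:
  assumes V: "open V" "V \<subseteq> U" and F: "X \<in> F" "Y \<in> F" "Z \<in> F"
  shows "curvature A (nabla V) (restrict_field V X) (restrict_field V Y) (restrict_field V Z)
    = restrict_field V (R X Y Z)"
proof -
  interpret V: space_form_open A g nabla K V
    by unfold_locales (use metric levi_civita sectional K_nonzero V in auto)
  show ?thesis
    using F V by (simp add: R_eq V.R_eq restrict_field_vector_fields restrict_field_diff nabla_restrict D_F
        vector_fields_diff)
qed

text \<open>The defect at \<open>p\<close> does not change when the fields are restricted to a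
  neighbourhood \<open>V\<close> of \<open>p\<close>, and \<open>V\<close> can be taken inside a
  chart, where the coordinate fields form a frame.\<close>

lemma defect_diagonal:
  assumes F: "X \<in> F" "Y \<in> F" and p: "p \<in> U"
  shows "defect p X Y Y X = 0"
proof -
  obtain V E1 E2 where V: "open V" "p \<in> V" "V \<subseteq> U"
    and E: "E1 \<in> vector_fields A V" "E2 \<in> vector_fields A V" "independent_vectors (E1 p) (E2 p)"
    by (rule local_frame[OF open_U p])
  interpret V: space_form_open A g nabla K V
    by unfold_locales (use metric levi_civita sectional K_nonzero V in auto)
  have "V.defect p (restrict_field V X) (restrict_field V Y) (restrict_field V Y) (restrict_field V X) = 0"
    using F V by (intro V.defect_diagonal_frame[OF _ _ V(2) E] restrict_field_vector_fields)
  then show ?thesis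
    using curvature_restrict[OF V(1,3) F F(2)] V(2)
    by (simp add: defect_def V.defect_def) (simp add: restrict_field_def)
qed

lemma curvature_formula:
  assumes "X \<in> F" "Y \<in> F" "Z \<in> F" "W \<in> F" "p \<in> U"
  shows "g p (R X Y Z p) (W p)
    = K * (g p (Y p) (Z p) * g p (X p) (W p) - g p (X p) (Z p) * g p (Y p) (W p))"
proof -
  have "defect p X Y Z W = 0"
    by (rule curvature_like_eq_0[of F "defect p"])
      ((rule vector_fields_add defect_add2 defect_add3 defect_bianchi; assumption)
        | (rule defect_swap12; assumption) | (rule defect_swap34; (assumption | rule assms(5)))
        | (rule defect_diagonal; (assumption | rule assms(5))) | rule assms)+
  then show ?thesis
    by (simp add: defect_def)
qed

lemma R_parallel:
  assumes F: "V \<in> F" "X \<in> F" "Y \<in> F" "Z \<in> F"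
  shows "D V (R X Y Z) = R (D V X) Y Z + R X (D V Y) Z + R X Y (D V Z)"
proof -
  let ?E = "D V (R X Y Z) - (R (D V X) Y Z + R X (D V Y) Z + R X Y (D V Z))"
  have E: "?E \<in> F"
    using F by (simp add: D_F R_F vector_fields_add vector_fields_diff)
  have "?E p = 0" if p: "p \<in> U" for p
  proof -
    have ortho: "g p (?E p) (W p) = 0" if W: "W \<in> F" for W
    proof -
      let ?h = "\<lambda>X Y q. g q (X q) (Y q)"
      note near = g_smooth_near[OF _ _ p]
      note V = field_tangent[OF F(1), of p]
      have n1: "smooth_near A p (\<lambda>q. ?h Y Z q * ?h X W q)" and n2: "smooth_near A p (\<lambda>q. ?h X Z q * ?h Y W q)"
        using F W by (intro smooth_near_mult near; simp)+
      have n3: "smooth_near A p (\<lambda>q. ?h Y Z q * ?h X W q - ?h X Z q * ?h Y W q)"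
        using smooth_near_add[OF n1 smooth_near_minus[OF n2]] by simp
      have n4: "smooth_near A p (?h (R X Y Z) W)"
        using F W by (intro near R_F)
      have "V p (?h (R X Y Z) W) = V p (\<lambda>q. K * (?h Y Z q * ?h X W q - ?h X Z q * ?h Y W q))"
        using F W by (intro tangent_cong_open[OF V n4 open_U p] curvature_formula)
      also have "\<dots> = K * (V p (\<lambda>q. ?h Y Z q * ?h X W q) - V p (\<lambda>q. ?h X Z q * ?h Y W q))"
        by (simp only: tangent_scale[OF V n3] tangent_diff[OF V n1 n2])
      also have "V p (\<lambda>q. ?h Y Z q * ?h X W q) = ?h Y Z p * V p (?h X W) + ?h X W p * V p (?h Y Z)"
        using F W by (intro tangent_mult[OF V] near)
      also have "V p (\<lambda>q. ?h X Z q * ?h Y W q) = ?h X Z p * V p (?h Y W) + ?h Y W p * V p (?h X Z)"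
        using F W by (intro tangent_mult[OF V] near)
      \<comment> \<open>Expanding by \<open>compatible\<close>, the terms containing the derivative
        of \<open>W\<close> match by \<open>curvature_formula\<close>; the others are
        \<open>curvature_formula\<close> with one of \<open>X\<close>, \<open>Y\<close>,
        \<open>Z\<close> differentiated.\<close>
      finally show ?thesis
        using F W p
        by (simp add: compatible D_F R_F curvature_formula g_add_left g_diff_left tangent_space_add
            field_tangent algebra_simps)
    qed
    \<comment> \<open>\<open>?E\<close> is itself a field over \<open>U\<close>, hence its own test
      field; positive definiteness finishes.\<close>
    show ?thesis
      using ortho[OF E] g_pos[OF field_tangent[OF E]] by force
  qed
  then have "?E = 0"
    using vector_fields_outside[OF E] by (auto simp: fun_eq_iff)
  then show ?thesis
    by simp
qed

end

section \<open>Iterated covariant derivatives with parallel curvature\<close>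

text \<open>The action of \<open>e\<close> on covariant tensors as a derivation, up to sign. It
  covers both the subtracted sum in \<open>cov_deriv\<close>, with \<open>e\<close> the map
  \<open>complex_ext D Z\<close>, and the right-hand side of the commutation formula, with
  \<open>e\<close> the negative of \<open>R X Y\<close>.\<close>

definition slot_sum :: "('v \<Rightarrow> 'v) \<Rightarrow> ('v list \<Rightarrow> 'c::ab_group_add) \<Rightarrow> 'v list \<Rightarrow> 'c" where
  "slot_sum e T Ws = (\<Sum>j<length Ws. T (Ws[j := e (Ws ! j)]))"

lemma slot_sum_Nil [simp]: "slot_sum e T [] = 0"
  by (simp add: slot_sum_def)

lemma slot_sum_Cons [simp]:
  "slot_sum e T (x # xs) = T (e x # xs) + slot_sum e (\<lambda>ys. T (x # ys)) xs"
  by (simp add: slot_sum_def sum.lessThan_Suc_shift del: sum.lessThan_Suc)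

lemma slot_sum_append:
  "slot_sum e T (xs @ ys) = slot_sum e (\<lambda>as. T (as @ ys)) xs + slot_sum e (\<lambda>bs. T (xs @ bs)) ys"
  by (induction xs arbitrary: T) (simp_all add: add.assoc)

lemma slot_sum_add: "slot_sum e (\<lambda>ws. S ws + T ws) Ws = slot_sum e S Ws + slot_sum e T Ws"
  by (simp add: slot_sum_def sum.distrib)

lemma slot_sum_diff: "slot_sum e (\<lambda>ws. S ws - T ws) Ws = slot_sum e S Ws - slot_sum e T Ws"
  by (simp add: slot_sum_def sum_subtractf)

lemma slot_sum_exchange:
  "slot_sum d (\<lambda>ws. slot_sum e (\<lambda>vs. T vs ws) Vs) Ws = slot_sum e (\<lambda>vs. slot_sum d (T vs) Ws) Vs"
  unfolding slot_sum_def by (rule sum.swap)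

text \<open>Terms altering two different slots occur in both orders and cancel. Composition is
  reversed on the right: the outer sum changes the argument first, so in the first term
  \<open>d\<close> acts before \<open>e\<close>.\<close>

lemma slot_sum_commutator:
  "slot_sum d (slot_sum e T) Ws - slot_sum e (slot_sum d T) Ws
    = slot_sum (\<lambda>w. e (d w)) T Ws - slot_sum (\<lambda>w. d (e w)) T Ws"
proof (induction Ws arbitrary: T)
  case Nil
  show ?case by simp
next
  case (Cons x xs)
  show ?case
    using Cons.IH[of "\<lambda>ys. T (x # ys)"] by (simp add: slot_sum_add algebra_simps)
qed

lemma slot_sum_cong:
  assumes "\<And>w. w \<in> V \<Longrightarrow> e w \<in> V" "set Ws \<subseteq> V"
    and "\<And>ws. length ws = length Ws \<Longrightarrow> set ws \<subseteq> V \<Longrightarrow> S ws = T ws"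
  shows "slot_sum e S Ws = slot_sum e T Ws"
  unfolding slot_sum_def
proof (rule sum.cong[OF refl])
  fix j assume "j \<in> {..<length Ws}"
  then show "S (Ws[j := e (Ws ! j)]) = T (Ws[j := e (Ws ! j)])"
    using assms(1,2) by (intro assms(3) set_update_subsetI) (auto simp: subset_iff)
qed

lemma slot_sum_cong_slot:
  "(\<And>w. w \<in> set Ws \<Longrightarrow> d w = e w) \<Longrightarrow> slot_sum d T Ws = slot_sum e T Ws"
  by (simp add: slot_sum_def)

text \<open>Isolates what the commutation formula uses of fields (\<open>VF\<close>), functions
  (\<open>SF\<close>) and the action \<open>ap\<close> of the former on the latter. Addition is the
  only linear structure, and brackets appear as \<open>D X Y - D Y X\<close>.\<close>

locale parallel_connection =
  fixes VF :: "'v::ab_group_add set" and SF :: "'c::ab_group_add set"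
    and D :: "'v \<Rightarrow> 'v \<Rightarrow> 'v" and ap :: "'v \<Rightarrow> 'c \<Rightarrow> 'c" and R :: "'v \<Rightarrow> 'v \<Rightarrow> 'v \<Rightarrow> 'v"
    and N :: "nat \<Rightarrow> 'v list \<Rightarrow> 'c" and f :: 'c
  assumes VF_add: "X \<in> VF \<Longrightarrow> Y \<in> VF \<Longrightarrow> X + Y \<in> VF"
    and VF_minus: "X \<in> VF \<Longrightarrow> - X \<in> VF"
    and SF_zero: "0 \<in> SF"
    and SF_add: "h \<in> SF \<Longrightarrow> k \<in> SF \<Longrightarrow> h + k \<in> SF"
    and SF_minus: "h \<in> SF \<Longrightarrow> - h \<in> SF"
    and D_VF: "X \<in> VF \<Longrightarrow> Y \<in> VF \<Longrightarrow> D X Y \<in> VF"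
    and D_add_left: "X \<in> VF \<Longrightarrow> Y \<in> VF \<Longrightarrow> Z \<in> VF \<Longrightarrow> D (X + Y) Z = D X Z + D Y Z"
    and D_add_right: "X \<in> VF \<Longrightarrow> Y \<in> VF \<Longrightarrow> Z \<in> VF \<Longrightarrow> D Z (X + Y) = D Z X + D Z Y"
    and ap_SF: "X \<in> VF \<Longrightarrow> h \<in> SF \<Longrightarrow> ap X h \<in> SF"
    and ap_add_left: "X \<in> VF \<Longrightarrow> Y \<in> VF \<Longrightarrow> h \<in> SF \<Longrightarrow> ap (X + Y) h = ap X h + ap Y h"
    and ap_add_right: "X \<in> VF \<Longrightarrow> h \<in> SF \<Longrightarrow> k \<in> SF \<Longrightarrow> ap X (h + k) = ap X h + ap X k"
    and torsion_free: "X \<in> VF \<Longrightarrow> Y \<in> VF \<Longrightarrow> h \<in> SF \<Longrightarrow>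
      ap (D X Y - D Y X) h = ap X (ap Y h) - ap Y (ap X h)"
    and R_def: "X \<in> VF \<Longrightarrow> Y \<in> VF \<Longrightarrow> Z \<in> VF \<Longrightarrow>
      R X Y Z = D X (D Y Z) - D Y (D X Z) - D (D X Y - D Y X) Z"
    and R_parallel: "V \<in> VF \<Longrightarrow> X \<in> VF \<Longrightarrow> Y \<in> VF \<Longrightarrow> Z \<in> VF \<Longrightarrow>
      D V (R X Y Z) = R (D V X) Y Z + R X (D V Y) Z + R X Y (D V Z)"
    and N_0: "N 0 Ws = f"
    and N_Suc: "N (Suc n) (X # Ws) = ap X (N n Ws) - slot_sum (D X) (N n) Ws"
    and f_SF: "f \<in> SF"
begin

lemma VF_diff: "X \<in> VF \<Longrightarrow> Y \<in> VF \<Longrightarrow> X - Y \<in> VF"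
  using VF_add VF_minus by (metis uminus_add_conv_diff)

lemma SF_diff: "h \<in> SF \<Longrightarrow> k \<in> SF \<Longrightarrow> h - k \<in> SF"
  using SF_add SF_minus by (metis uminus_add_conv_diff)

lemma R_VF: "X \<in> VF \<Longrightarrow> Y \<in> VF \<Longrightarrow> Z \<in> VF \<Longrightarrow> R X Y Z \<in> VF"
  by (simp add: R_def D_VF VF_diff)

lemma D_minus_right: "X \<in> VF \<Longrightarrow> V \<in> VF \<Longrightarrow> D V (- X) = - D V X"
  using D_add_right[of X "- X" V] D_add_right[of 0 0 V] VF_diff[of X X] VF_minus[of X]
  by (simp add: eq_neg_iff_add_eq_0 add.commute[of "D V X"])

lemma ap_0: "X \<in> VF \<Longrightarrow> ap X 0 = 0"
  using ap_add_right[of X 0 0] SF_zero by simp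

lemma ap_diff_right: "X \<in> VF \<Longrightarrow> h \<in> SF \<Longrightarrow> k \<in> SF \<Longrightarrow> ap X (h - k) = ap X h - ap X k"
  using ap_add_right[of X "h - k" k] SF_diff[of h k] by (simp add: algebra_simps)

lemma ap_sum:
  "X \<in> VF \<Longrightarrow> (\<And>i. i \<in> I \<Longrightarrow> h i \<in> SF) \<Longrightarrow> ap X (\<Sum>i\<in>I. h i) = (\<Sum>i\<in>I. ap X (h i)) \<and> (\<Sum>i\<in>I. h i) \<in> SF"
  by (induction I rule: infinite_finite_induct) (auto simp: ap_0 ap_add_right SF_zero SF_add)

text \<open>Additivity in every slot is what allows slot sums to be merged; values in
  \<open>SF\<close> are what \<open>ap\<close> may be applied to.\<close>

definition tensor :: "nat \<Rightarrow> ('v list \<Rightarrow> 'c) \<Rightarrow> bool" where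
  "tensor l T \<longleftrightarrow> (\<forall>Ws. length Ws = l \<and> set Ws \<subseteq> VF \<longrightarrow> T Ws \<in> SF) \<and>
     (\<forall>As Bs X Y. length As + Suc (length Bs) = l \<and> set As \<subseteq> VF \<and> set Bs \<subseteq> VF \<and> X \<in> VF \<and> Y \<in> VF
        \<longrightarrow> T (As @ (X + Y) # Bs) = T (As @ X # Bs) + T (As @ Y # Bs))"

lemma tensor_SF: "tensor l T \<Longrightarrow> length Ws = l \<Longrightarrow> set Ws \<subseteq> VF \<Longrightarrow> T Ws \<in> SF"
  by (simp add: tensor_def)

lemma tensor_add:
  "tensor l T \<Longrightarrow> length As + Suc (length Bs) = l \<Longrightarrow> set As \<subseteq> VF \<Longrightarrow> set Bs \<subseteq> VF \<Longrightarrow> X \<in> VF \<Longrightarrow> Y \<in> VF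
    \<Longrightarrow> T (As @ (X + Y) # Bs) = T (As @ X # Bs) + T (As @ Y # Bs)"
  by (simp add: tensor_def)

lemma tensor_diff:
  assumes "tensor l T" "length As + Suc (length Bs) = l" "set As \<subseteq> VF" "set Bs \<subseteq> VF" "X \<in> VF" "Y \<in> VF"
  shows "T (As @ (X - Y) # Bs) = T (As @ X # Bs) - T (As @ Y # Bs)"
  using tensor_add[OF assms(1-4) VF_diff[OF assms(5,6)] assms(6)] by simp

lemma tensor_Cons: "tensor (Suc l) T \<Longrightarrow> x \<in> VF \<Longrightarrow> tensor l (\<lambda>ws. T (x # ws))"
  unfolding tensor_def by (auto simp flip: append_Cons)

lemma tensor_append: "tensor (length Vs + l) T \<Longrightarrow> set Vs \<subseteq> VF \<Longrightarrow> tensor l (\<lambda>ws. T (Vs @ ws))"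
  by (induction Vs arbitrary: T) (auto dest: tensor_Cons)

lemma slot_sum_SF_ap:
  assumes "X \<in> VF" "tensor l T" "length Ws = l" "set Ws \<subseteq> VF" "\<And>w. w \<in> VF \<Longrightarrow> e w \<in> VF"
  shows "slot_sum e T Ws \<in> SF"
    and "ap X (slot_sum e T Ws) = slot_sum e (\<lambda>ws. ap X (T ws)) Ws"
proof -
  have "T (Ws[j := e (Ws ! j)]) \<in> SF" if "j \<in> {..<length Ws}" for j
    using assms(3-5) that by (intro tensor_SF[OF assms(2)] set_update_subsetI) (auto simp: subset_iff)
  then show "slot_sum e T Ws \<in> SF"
    and "ap X (slot_sum e T Ws) = slot_sum e (\<lambda>ws. ap X (T ws)) Ws"
    using ap_sum[OF assms(1), of "{..<length Ws}" "\<lambda>j. T (Ws[j := e (Ws ! j)])"]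
    unfolding slot_sum_def by blast+
qed

lemma slot_sum_add_slot:
  assumes "tensor l T" "length Ws = l" "set Ws \<subseteq> VF"
    and "\<And>w. w \<in> VF \<Longrightarrow> d w \<in> VF" "\<And>w. w \<in> VF \<Longrightarrow> e w \<in> VF"
  shows "slot_sum (\<lambda>w. d w + e w) T Ws = slot_sum d T Ws + slot_sum e T Ws"
  using assms(1-3)
proof (induction Ws arbitrary: l T)
  case (Cons x xs)
  have "T ((d x + e x) # xs) = T (d x # xs) + T (e x # xs)"
    using Cons.prems assms(4,5) tensor_add[OF Cons.prems(1), of "[]" xs] by auto
  then show ?case
    using Cons.IH[of "length xs" "\<lambda>ys. T (x # ys)"] tensor_Cons[of "length xs" T x] Cons.prems
    by (auto simp: algebra_simps)
qed simp

lemma slot_sum_diff_slot: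
  assumes "tensor l T" "length Ws = l" "set Ws \<subseteq> VF"
    and "\<And>w. w \<in> VF \<Longrightarrow> d w \<in> VF" "\<And>w. w \<in> VF \<Longrightarrow> e w \<in> VF"
  shows "slot_sum (\<lambda>w. d w - e w) T Ws = slot_sum d T Ws - slot_sum e T Ws"
  using slot_sum_add_slot[OF assms(1-3), of "\<lambda>w. d w - e w" e] assms(4,5) VF_diff by simp

text \<open>In the first slot, additivity comes from \<open>D\<close> and \<open>ap\<close> being
  additive in the differentiating field. For a later slot the slot sum splits into the slots before,
  at and after it, and the induction hypothesis applies to each, with \<open>D_add_right\<close> for
  the slot itself.\<close>

lemma tensor_N: "tensor n (N n)"
proof (induction n)
  case 0
  show ?case by (auto simp: tensor_def N_0 f_SF)
next
  case (Suc n)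
  have hd_add: "N (Suc n) ((X + Y) # Bs) = N (Suc n) (X # Bs) + N (Suc n) (Y # Bs)"
    if "length Bs = n" "set Bs \<subseteq> VF" "X \<in> VF" "Y \<in> VF" for X Y Bs
  proof -
    have "slot_sum (D (X + Y)) (N n) Bs = slot_sum (\<lambda>w. D X w + D Y w) (N n) Bs"
      using that by (intro slot_sum_cong_slot D_add_left) auto
    also have "\<dots> = slot_sum (D X) (N n) Bs + slot_sum (D Y) (N n) Bs"
      using that D_VF by (intro slot_sum_add_slot[OF Suc]) auto
    finally show ?thesis
      using that tensor_SF[OF Suc] by (simp add: N_Suc ap_add_left)
  qed
  have tl_add: "N (Suc n) (V # As @ (X + Y) # Bs) = N (Suc n) (V # As @ X # Bs) + N (Suc n) (V # As @ Y # Bs)"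
    if "length As + Suc (length Bs) = n" "set As \<subseteq> VF" "set Bs \<subseteq> VF" "X \<in> VF" "Y \<in> VF" "V \<in> VF"
    for V As X Y Bs
  proof -
    note mem = that(2-6)
    have "slot_sum (D V) (\<lambda>as. N n (as @ (X + Y) # Bs)) As
        = slot_sum (D V) (\<lambda>as. N n (as @ X # Bs) + N n (as @ Y # Bs)) As"
      using that D_VF by (intro slot_sum_cong[of VF] tensor_add[OF Suc]) auto
    moreover have "slot_sum (D V) (\<lambda>bs. N n (As @ (X + Y) # bs)) Bs
        = slot_sum (D V) (\<lambda>bs. N n (As @ X # bs) + N n (As @ Y # bs)) Bs"
      using that D_VF by (intro slot_sum_cong[of VF] tensor_add[OF Suc]) auto
    moreover have "N n (As @ D V (X + Y) # Bs) = N n (As @ D V X # Bs) + N n (As @ D V Y # Bs)"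
      using that D_VF D_add_right tensor_add[OF Suc] by simp
    moreover have "ap V (N n (As @ (X + Y) # Bs)) = ap V (N n (As @ X # Bs)) + ap V (N n (As @ Y # Bs))"
      using that tensor_SF[OF Suc] by (subst tensor_add[OF Suc]) (auto intro!: ap_add_right)
    ultimately show ?thesis
      by (simp add: N_Suc slot_sum_append slot_sum_add algebra_simps)
  qed
  have "N (Suc n) (As @ (X + Y) # Bs) = N (Suc n) (As @ X # Bs) + N (Suc n) (As @ Y # Bs)"
    if "length As + Suc (length Bs) = Suc n" "set As \<subseteq> VF" "set Bs \<subseteq> VF" "X \<in> VF" "Y \<in> VF" for As X Y Bs
    using that hd_add tl_add by (cases As) auto
  moreover have "N (Suc n) Ws \<in> SF" if "length Ws = Suc n" "set Ws \<subseteq> VF" for Ws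
  proof -
    obtain V Vs where Ws: "Ws = V # Vs" and len: "length Vs = n"
      using \<open>length Ws = Suc n\<close> by (auto simp: length_Suc_conv)
    have "slot_sum (D V) (N n) Vs \<in> SF"
      using that Ws D_VF by (intro slot_sum_SF_ap(1)[OF _ Suc len]) auto
    then show ?thesis
      using that Ws tensor_SF[OF Suc] ap_SF SF_diff by (simp add: N_Suc)
  qed
  ultimately show ?case
    unfolding tensor_def by blast
qed

text \<open>The Hessian is symmetric by torsion-freeness. A further derivative preserves this: it
  alters either an earlier slot or one of the last two, and the two terms of the latter kind are
  exchanged.\<close>

lemma N_symmetric:
  assumes "length Vs = k" "set Vs \<subseteq> VF" "X \<in> VF" "Y \<in> VF"
  shows "N (k + 2) (Vs @ [X, Y]) = N (k + 2) (Vs @ [Y, X])"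
  using assms
proof (induction k arbitrary: Vs X Y)
  case 0
  have "ap (D X Y - D Y X) f = ap (D X Y) f - ap (D Y X) f"
    using ap_add_left[of "D X Y - D Y X" "D Y X" f] 0 D_VF VF_diff f_SF by simp
  then show ?case
    using torsion_free[of X Y f] 0 f_SF by (simp add: numeral_2_eq_2 N_Suc N_0 algebra_simps)
next
  case (Suc k)
  then obtain V Vs' where Vs: "Vs = V # Vs'" and len: "length Vs' = k"
    by (auto simp: length_Suc_conv)
  have "slot_sum (D V) (\<lambda>as. N (k + 2) (as @ [X, Y])) Vs'
      = slot_sum (D V) (\<lambda>as. N (k + 2) (as @ [Y, X])) Vs'"
    using Suc Vs len D_VF by (intro slot_sum_cong[of VF] Suc.IH) auto
  moreover have "N (k + 2) (Vs' @ [A, B]) = N (k + 2) (Vs' @ [B, A])"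
    if "A \<in> VF" "B \<in> VF" for A B
    using Suc Vs len that by simp
  ultimately show ?case
    using Suc.prems Vs D_VF by (simp add: N_Suc slot_sum_append algebra_simps)
qed

text \<open>The left side antisymmetrises the second covariant derivative of the tensor
  \<open>N l\<close>. This gives the curvature operator, which acts on covariant tensors dually,
  hence with \<open>- R X Y\<close> in each slot.\<close>

lemma Ricci_identity:
  assumes "set Ws \<subseteq> VF" "X \<in> VF" "Y \<in> VF" "length Ws = l"
  shows "N (Suc (Suc l)) (X # Y # Ws) - N (Suc (Suc l)) (Y # X # Ws) = slot_sum (\<lambda>w. - R X Y w) (N l) Ws"
proof -
  let ?T = "N l" and ?B = "D X Y - D Y X"
  note tens = tensor_N[of l] tensor_SF[OF tensor_N[of l] assms(4,1)]
  \<comment> \<open>The two terms that differentiate the function in one direction and a slot in the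
    other form a sum symmetric in \<open>X\<close> and \<open>Y\<close>, and drop out of the
    difference.\<close>
  have expand: "N (Suc (Suc l)) (X # Y # Ws) = ap X (ap Y (?T Ws)) - slot_sum (D Y) (\<lambda>ws. ap X (?T ws)) Ws
      - N (Suc l) (D X Y # Ws) - slot_sum (D X) (\<lambda>ws. ap Y (?T ws)) Ws + slot_sum (D X) (slot_sum (D Y) ?T) Ws"
    if "X \<in> VF" "Y \<in> VF" for X Y
    using that assms tens D_VF ap_SF slot_sum_SF_ap[OF that(1) tensor_N assms(4,1), of "D Y"]
    by (simp add: N_Suc slot_sum_diff ap_diff_right algebra_simps)
  have "N (Suc l) (D X Y # Ws) - N (Suc l) (D Y X # Ws) = N (Suc l) (?B # Ws)"
    using tensor_diff[OF tensor_N[of "Suc l"], of "[]" Ws] assms D_VF by simp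
  also have "\<dots> = ap X (ap Y (?T Ws)) - ap Y (ap X (?T Ws)) - slot_sum (D ?B) ?T Ws"
    using torsion_free assms tens by (simp add: N_Suc)
  finally have B: "N (Suc l) (D X Y # Ws) - N (Suc l) (D Y X # Ws)
      = ap X (ap Y (?T Ws)) - ap Y (ap X (?T Ws)) - slot_sum (D ?B) ?T Ws" .
  have "N (Suc (Suc l)) (X # Y # Ws) - N (Suc (Suc l)) (Y # X # Ws)
      = ap X (ap Y (?T Ws)) - ap Y (ap X (?T Ws)) - (N (Suc l) (D X Y # Ws) - N (Suc l) (D Y X # Ws))
        + (slot_sum (D X) (slot_sum (D Y) ?T) Ws - slot_sum (D Y) (slot_sum (D X) ?T) Ws)"
    using assms by (simp add: expand)
  also have "\<dots> = slot_sum (D ?B) ?T Ws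
        + (slot_sum (D X) (slot_sum (D Y) ?T) Ws - slot_sum (D Y) (slot_sum (D X) ?T) Ws)"
    unfolding B by simp
  \<comment> \<open>The reversed composition in \<open>slot_sum_commutator\<close> is the source of
    the sign in front of \<open>R\<close>.\<close>
  also have "\<dots> = slot_sum (\<lambda>w. D ?B w + (D Y (D X w) - D X (D Y w))) ?T Ws"
    using assms D_VF VF_diff
    by (simp add: slot_sum_commutator slot_sum_add_slot[OF tensor_N] slot_sum_diff_slot[OF tensor_N])
  also have "\<dots> = slot_sum (\<lambda>w. - R X Y w) ?T Ws"
    using assms by (intro slot_sum_cong_slot) (auto simp: R_def)
  finally show ?thesis .
qed

text \<open>Induction on the number of derivatives taken after the commuted pair. Differentiating
  along \<open>V\<close> replaces \<open>X\<close>, \<open>Y\<close> and the entries of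
  \<open>Vs\<close> and \<open>Ws\<close> by their derivatives, so all of them are
  generalised.\<close>

lemma N_commute:
  assumes "length Vs = k" "set Vs \<subseteq> VF" "set Ws \<subseteq> VF" "X \<in> VF" "Y \<in> VF" "length Ws = l"
  shows "N (k + Suc (Suc l)) (Vs @ X # Y # Ws) - N (k + Suc (Suc l)) (Vs @ Y # X # Ws)
    = slot_sum (\<lambda>w. - R X Y w) (\<lambda>ws. N (k + l) (Vs @ ws)) Ws"
  using assms
proof (induction k arbitrary: Vs X Y Ws)
  case 0
  then show ?case using Ricci_identity by simp
next
  case (Suc k Us)
  then obtain V Vs where Us: "Us = V # Vs" and len: "length Vs = k"
    by (auto simp: length_Suc_conv)
  let ?r = "\<lambda>X Y w. - R X Y w"
  let ?n = "k + Suc (Suc l)" and ?M = "N (k + l)" and ?d = "D V"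
  let ?L = "\<lambda>vs X Y ws. N ?n (vs @ X # Y # ws) - N ?n (vs @ Y # X # ws)"
  let ?\<Phi> = "\<lambda>ws. ?M (Vs @ ws)"
  have mem: "set Vs \<subseteq> VF" "set Ws \<subseteq> VF" "X \<in> VF" "Y \<in> VF" "V \<in> VF" "D V X \<in> VF" "D V Y \<in> VF"
    using Suc.prems Us D_VF by auto
  have r_VF: "?r X Y w \<in> VF" if "X \<in> VF" "Y \<in> VF" "w \<in> VF" for X Y w
    using R_VF VF_minus that by blast
  have IH: "?L vs X Y ws = slot_sum (?r X Y) (\<lambda>ws. ?M (vs @ ws)) ws"
    if "set vs \<subseteq> VF" "set ws \<subseteq> VF" "X \<in> VF" "Y \<in> VF" "length ws = l" "length vs = k" for vs X Y ws
    by (rule Suc.IH) (use that in auto)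
  have tens: "tensor l ?\<Phi>"
    using tensor_append[of Vs l ?M] tensor_N len mem by blast
  have in_SF: "N ?n (Vs @ A # B # Ws) \<in> SF" if "A \<in> VF" "B \<in> VF" for A B
    using that mem Suc.prems len by (intro tensor_SF[OF tensor_N]) auto
  \<comment> \<open>The slot sum of \<open>D V\<close> runs over \<open>Vs\<close>, the pair and
    \<open>Ws\<close>; the induction hypothesis is then applied to each kind of term.\<close>
  have "N (Suc ?n) (V # Vs @ X # Y # Ws) - N (Suc ?n) (V # Vs @ Y # X # Ws)
      = ap V (?L Vs X Y Ws) - slot_sum ?d (\<lambda>vs. ?L vs X Y Ws) Vs
        - ?L Vs (D V X) Y Ws - ?L Vs X (D V Y) Ws - slot_sum ?d (\<lambda>ws. ?L Vs X Y ws) Ws"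
    using in_SF mem by (simp add: N_Suc slot_sum_append slot_sum_diff ap_diff_right)
  moreover have "ap V (?L Vs X Y Ws) = slot_sum (?r X Y) (\<lambda>ws. ap V (?\<Phi> ws)) Ws"
    using slot_sum_SF_ap(2)[OF mem(5) tens Suc.prems(6) mem(2), of "?r X Y"] r_VF[OF mem(3,4)]
      IH[OF mem(1-4) Suc.prems(6) len] by simp
  moreover have "?L Vs (D V X) Y Ws = slot_sum (?r (D V X) Y) ?\<Phi> Ws"
    by (rule IH) (use mem Suc.prems len in auto)
  moreover have "?L Vs X (D V Y) Ws = slot_sum (?r X (D V Y)) ?\<Phi> Ws"
    by (rule IH) (use mem Suc.prems len in auto)
  moreover have "slot_sum ?d (\<lambda>vs. ?L vs X Y Ws) Vs
      = slot_sum ?d (\<lambda>vs. slot_sum (?r X Y) (\<lambda>ws. ?M (vs @ ws)) Ws) Vs"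
    using mem Suc.prems D_VF len by (intro slot_sum_cong[of VF] IH) auto
  moreover have "\<dots> = slot_sum (?r X Y) (\<lambda>ws. slot_sum ?d (\<lambda>vs. ?M (vs @ ws)) Vs) Ws"
    by (rule slot_sum_exchange)
  moreover have "slot_sum ?d (\<lambda>ws. ?L Vs X Y ws) Ws = slot_sum ?d (slot_sum (?r X Y) ?\<Phi>) Ws"
    using mem Suc.prems D_VF len by (intro slot_sum_cong[of VF] IH) auto
  ultimately have lhs: "N (Suc ?n) (V # Vs @ X # Y # Ws) - N (Suc ?n) (V # Vs @ Y # X # Ws)
      = slot_sum (?r X Y) (\<lambda>ws. ap V (?\<Phi> ws)) Ws
        - slot_sum (?r X Y) (\<lambda>ws. slot_sum ?d (\<lambda>vs. ?M (vs @ ws)) Vs) Ws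
        - slot_sum (?r (D V X) Y) ?\<Phi> Ws - slot_sum (?r X (D V Y)) ?\<Phi> Ws
        - slot_sum ?d (slot_sum (?r X Y) ?\<Phi>) Ws"
    by (simp only:)
  \<comment> \<open>Parallel curvature says that the commutator of \<open>D V\<close> with
    \<open>R X Y\<close> on a single field is \<open>R (D V X) Y + R X (D V Y)\<close>; these are
    the terms produced when \<open>D V\<close> hits the pair.\<close>
  have "slot_sum (?r X Y) (slot_sum ?d ?\<Phi>) Ws - slot_sum ?d (slot_sum (?r X Y) ?\<Phi>) Ws
      = slot_sum (\<lambda>w. D V (?r X Y w) - ?r X Y (D V w)) ?\<Phi> Ws"
    using slot_sum_diff_slot[OF tens Suc.prems(6) mem(2), of "\<lambda>w. D V (?r X Y w)" "\<lambda>w. ?r X Y (D V w)"]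
      r_VF mem D_VF by (simp add: slot_sum_commutator)
  also have "\<dots> = slot_sum (\<lambda>w. ?r (D V X) Y w + ?r X (D V Y) w) ?\<Phi> Ws"
  proof (rule slot_sum_cong_slot)
    fix w assume "w \<in> set Ws"
    then have w: "w \<in> VF" using mem by blast
    have "D V (?r X Y w) = - D V (R X Y w)"
      by (rule D_minus_right) (use R_VF mem w in auto)
    then show "D V (?r X Y w) - ?r X Y (D V w) = ?r (D V X) Y w + ?r X (D V Y) w"
      by (simp add: R_parallel[OF mem(5,3,4) w])
  qed
  also have "\<dots> = slot_sum (?r (D V X) Y) ?\<Phi> Ws + slot_sum (?r X (D V Y)) ?\<Phi> Ws"
    using mem r_VF by (intro slot_sum_add_slot[OF tens Suc.prems(6) mem(2)]) auto
  finally have "slot_sum (?r X Y) (slot_sum ?d ?\<Phi>) Ws = slot_sum (?r (D V X) Y) ?\<Phi> Ws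
      + slot_sum (?r X (D V Y)) ?\<Phi> Ws + slot_sum ?d (slot_sum (?r X Y) ?\<Phi>) Ws"
    by (simp only: diff_eq_eq)
  then show ?case
    using lhs by (simp add: Us N_Suc slot_sum_append slot_sum_diff slot_sum_add)
qed

end

section \<open>Complexification\<close>

lemma (in smooth_manifold) smooth_fun_complex_iff:
  fixes h :: "'m \<Rightarrow> complex"
  assumes "open U"
  shows "smooth_fun A U h \<longleftrightarrow> smooth_fun A U (\<lambda>q. Re (h q)) \<and> smooth_fun A U (\<lambda>q. Im (h q))"
proof
  assume "smooth_fun A U h"
  then show "smooth_fun A U (\<lambda>q. Re (h q)) \<and> smooth_fun A U (\<lambda>q. Im (h q))"
    using smooth_fun_bounded_linear[OF assms] bounded_linear_Re bounded_linear_Im by blast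
next
  assume "smooth_fun A U (\<lambda>q. Re (h q)) \<and> smooth_fun A U (\<lambda>q. Im (h q))"
  then have "smooth_fun A U (\<lambda>q. complex_of_real (Re (h q)) + complex_of_real (Im (h q)) * \<i>)"
    using smooth_fun_bounded_linear[OF assms bounded_linear_of_real]
      smooth_fun_bounded_linear[OF assms bounded_linear_mult_left, of "\<lambda>q. complex_of_real (Im (h q))" \<i>]
    by (intro smooth_fun_add[OF assms]) auto
  then show "smooth_fun A U h"
    by (rule smooth_fun_cong[OF assms]) (simp add: complex_eq_iff)
qed

lemma sum_fun_eval: "(\<Sum>i\<in>I. f i) x = (\<Sum>i\<in>I. f i x)"
  by (induction I rule: infinite_finite_induct) auto

text \<open>The recursion as an equation between functions rather than values, the form of
  \<open>N_Suc\<close>.\<close>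

lemma nabla_pow_Cons:
  "nabla_pow D (Suc n) f (X # Ws)
    = apply_cfield X (nabla_pow D n f Ws) - slot_sum (complex_ext D X) (nabla_pow D n f) Ws"
  by (auto simp: cov_deriv_def slot_sum_def sum_fun_eval)

context space_form_open
begin

abbreviation "CF \<equiv> cvector_fields A U"
abbreviation "cD \<equiv> complex_ext (nabla U)"
abbreviation "cR \<equiv> ccurvature A (nabla U)"
abbreviation "SF \<equiv> {h :: 'm \<Rightarrow> complex. smooth_fun A U h}"

lemma mem_CF: "(X, Y) \<in> CF \<longleftrightarrow> X \<in> F \<and> Y \<in> F"
  by (simp add: cvector_fields_def)

lemma cD_Pair: "cD (X, Y) (V, W) = (D X V - D Y W, D X W + D Y V)"
  by (simp add: complex_ext_def)

lemma R_diff1: "X \<in> F \<Longrightarrow> X' \<in> F \<Longrightarrow> Y \<in> F \<Longrightarrow> Z \<in> F \<Longrightarrow> R (X - X') Y Z = R X Y Z - R X' Y Z"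
  and R_diff2: "X \<in> F \<Longrightarrow> X' \<in> F \<Longrightarrow> Y \<in> F \<Longrightarrow> Z \<in> F \<Longrightarrow> R Y (X - X') Z = R Y X Z - R Y X' Z"
  and R_diff3: "X \<in> F \<Longrightarrow> X' \<in> F \<Longrightarrow> Y \<in> F \<Longrightarrow> Z \<in> F \<Longrightarrow> R Y Z (X - X') = R Y Z X - R Y Z X'"
  using R_add1[of "X - X'" X' Y Z] R_add2[of "X - X'" X' Y Z] R_add3[of "X - X'" X' Y Z]
    vector_fields_diff[of X U X'] by simp_all

text \<open>The complex-trilinear extension of the real \<open>R\<close>, with a minus sign wherever
  two imaginary parts meet; it reduces \<open>cR_parallel\<close> to
  \<open>R_parallel\<close>.\<close>

lemma cR_Pair:
  assumes "X1 \<in> F" "X2 \<in> F" "Y1 \<in> F" "Y2 \<in> F" "Z1 \<in> F" "Z2 \<in> F"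
  shows "cR (X1, X2) (Y1, Y2) (Z1, Z2)
    = (R X1 Y1 Z1 - R X1 Y2 Z2 - R X2 Y1 Z2 - R X2 Y2 Z1,
       R X1 Y1 Z2 + R X1 Y2 Z1 + R X2 Y1 Z1 - R X2 Y2 Z2)"
  using assms
  by (simp add: ccurvature_def curvature_def complex_ext_def D_F lb_F D_add_left D_add_right
      D_diff_left D_diff_right vector_fields_add vector_fields_diff)

lemma cR_eq:
  assumes "X \<in> CF" "Y \<in> CF"
  shows "cR X Y Z = cD X (cD Y Z) - cD Y (cD X Z) - cD (cD X Y - cD Y X) Z"
proof -
  have "complex_ext lb X Y = cD X Y - cD Y X"
    using assms by (cases X; cases Y) (simp add: mem_CF complex_ext_def lb_eq)
  then show ?thesis
    by (simp add: ccurvature_def)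
qed

lemma cR_parallel:
  assumes "V \<in> CF" "X \<in> CF" "Y \<in> CF" "Z \<in> CF"
  shows "cD V (cR X Y Z) = cR (cD V X) Y Z + cR X (cD V Y) Z + cR X Y (cD V Z)"
proof -
  obtain V1 V2 X1 X2 Y1 Y2 Z1 Z2 where eq: "V = (V1, V2)" "X = (X1, X2)" "Y = (Y1, Y2)" "Z = (Z1, Z2)"
    by (metis surj_pair)
  have F: "V1 \<in> F" "V2 \<in> F" "X1 \<in> F" "X2 \<in> F" "Y1 \<in> F" "Y2 \<in> F" "Z1 \<in> F" "Z2 \<in> F"
    using assms by (simp_all add: eq mem_CF)
  show ?thesis
    unfolding eq
    by (simp add: cR_Pair cD_Pair F D_F R_F vector_fields_add vector_fields_diff D_add_right D_diff_right
        R_parallel R_add1 R_add2 R_add3 R_diff1 R_diff2 R_diff3)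
qed

lemma Re_apply_cfield: "Re (apply_cfield (X, Y) h p) = X p (\<lambda>q. Re (h q)) - Y p (\<lambda>q. Im (h q))"
  and Im_apply_cfield: "Im (apply_cfield (X, Y) h p) = X p (\<lambda>q. Im (h q)) + Y p (\<lambda>q. Re (h q))"
  by (simp_all add: apply_cfield_def)

lemma SF_iff: "h \<in> SF \<longleftrightarrow> smooth_fun A U (\<lambda>q. Re (h q)) \<and> smooth_fun A U (\<lambda>q. Im (h q))"
  using smooth_fun_complex_iff[OF open_U] by simp

lemma field_smooth: "X \<in> F \<Longrightarrow> smooth_fun A U h \<Longrightarrow> smooth_fun A U (\<lambda>q. X q h)"
  using vector_fields_smooth[OF _ open_U] by blast

lemma apply_cfield_SF:
  assumes "X \<in> CF" "h \<in> SF"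
  shows "apply_cfield X h \<in> SF"
proof -
  obtain X1 X2 where X: "X = (X1, X2)" "X1 \<in> F" "X2 \<in> F"
    using assms(1) mem_CF by (cases X) auto
  have h: "smooth_fun A U (\<lambda>q. Re (h q))" "smooth_fun A U (\<lambda>q. Im (h q))"
    using assms(2) SF_iff by blast+
  show ?thesis
    unfolding SF_iff X(1) Re_apply_cfield Im_apply_cfield
    using smooth_fun_diff[OF open_U field_smooth[OF X(2) h(1)] field_smooth[OF X(3) h(2)]]
      smooth_fun_add[OF open_U field_smooth[OF X(2) h(2)] field_smooth[OF X(3) h(1)]] by (rule conjI)
qed

lemma field_add: "X \<in> F \<Longrightarrow> smooth_fun A U h \<Longrightarrow> smooth_fun A U k \<Longrightarrow>
    X p (\<lambda>q. h q + k q) = X p h + X p k"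
  using tangent_add[OF field_tangent, of X p h k] smooth_nearI[OF open_U, of p h]
    smooth_nearI[OF open_U, of p k] vector_fields_outside[of X U p]
  by (cases "p \<in> U") simp_all

lemma field_diff: "X \<in> F \<Longrightarrow> smooth_fun A U h \<Longrightarrow> smooth_fun A U k \<Longrightarrow>
    X p (\<lambda>q. h q - k q) = X p h - X p k"
  using tangent_diff[OF field_tangent, of X p h k] smooth_nearI[OF open_U, of p h]
    smooth_nearI[OF open_U, of p k] vector_fields_outside[of X U p]
  by (cases "p \<in> U") simp_all

lemma bracket_apply: "X \<in> F \<Longrightarrow> Y \<in> F \<Longrightarrow> smooth_fun A U h \<Longrightarrow>
    lb X Y p h = X p (\<lambda>q. Y q h) - Y p (\<lambda>q. X q h)"
  using lie_bracket_apply[OF open_U, of p h X Y] vector_fields_outside[of X U p]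
    vector_fields_outside[of Y U p] vector_fields_outside[OF lb_F, of X Y p] by (cases "p \<in> U") auto

lemma apply_cfield_commutator:
  assumes "X \<in> CF" "Y \<in> CF" "h \<in> SF"
  shows "apply_cfield (cD X Y - cD Y X) h
    = apply_cfield X (apply_cfield Y h) - apply_cfield Y (apply_cfield X h)"
proof -
  obtain X1 X2 Y1 Y2 where eq: "X = (X1, X2)" "Y = (Y1, Y2)"
    by (metis surj_pair)
  have F: "X1 \<in> F" "X2 \<in> F" "Y1 \<in> F" "Y2 \<in> F"
    using assms by (simp_all add: eq mem_CF)
  have h: "smooth_fun A U (\<lambda>q. Re (h q))" "smooth_fun A U (\<lambda>q. Im (h q))"
    using assms(3) SF_iff by blast+
  have "cD X Y - cD Y X = (lb X1 Y1 - lb X2 Y2, lb X1 Y2 + lb X2 Y1)"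
    using F by (simp add: eq cD_Pair lb_eq)
  then show ?thesis
    using F h
    by (simp add: fun_eq_iff complex_eq_iff eq Re_apply_cfield Im_apply_cfield bracket_apply
        F[THEN field_add] F[THEN field_diff] F[THEN field_smooth])
qed

text \<open>The laws are equations between functions on the whole type. Off \<open>U\<close>, where
  elements of \<open>SF\<close> are arbitrary, additivity in the function and the commutator law
  hold because the fields vanish there.\<close>

lemma parallel_connection:
  assumes "smooth_fun A U f"
  shows "parallel_connection CF SF cD apply_cfield cR (\<lambda>n. nabla_pow D n f) f"
proof
  show "X + Y \<in> CF" if "X \<in> CF" "Y \<in> CF" for X Y
    using that by (cases X; cases Y) (simp add: mem_CF vector_fields_add)
  show "- X \<in> CF" if "X \<in> CF" for X
    using that by (cases X) (simp add: mem_CF vector_fields_minus)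
  show "0 \<in> SF"
    using smooth_fun_const[OF open_U, of "0 :: complex"] by (simp add: zero_fun_def)
  show "h + k \<in> SF" if "h \<in> SF" "k \<in> SF" for h k
    using that smooth_fun_add[OF open_U, of h k] by (simp add: plus_fun_def)
  show "- h \<in> SF" if "h \<in> SF" for h
    using that smooth_fun_minus[OF open_U, of h] by (simp add: fun_Compl_def)
  show "cD X Y \<in> CF" if "X \<in> CF" "Y \<in> CF" for X Y
    using that by (cases X; cases Y) (simp add: mem_CF cD_Pair D_F vector_fields_add vector_fields_diff)
  show "cD (X + Y) Z = cD X Z + cD Y Z" if "X \<in> CF" "Y \<in> CF" "Z \<in> CF" for X Y Z
    using that by (cases X; cases Y; cases Z) (simp add: mem_CF cD_Pair D_add_left)
  show "cD Z (X + Y) = cD Z X + cD Z Y" if "X \<in> CF" "Y \<in> CF" "Z \<in> CF" for X Y Z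
    using that by (cases X; cases Y; cases Z) (simp add: mem_CF cD_Pair D_add_right)
  show "apply_cfield X h \<in> SF" if "X \<in> CF" "h \<in> SF" for X h
    using that by (rule apply_cfield_SF)
  show "apply_cfield (X + Y) h = apply_cfield X h + apply_cfield Y h" for X Y h
    by (cases X; cases Y) (simp add: fun_eq_iff complex_eq_iff Re_apply_cfield Im_apply_cfield)
  show "apply_cfield X (h + k) = apply_cfield X h + apply_cfield X k"
    if X: "X \<in> CF" and h: "h \<in> SF" and k: "k \<in> SF" for X h k
  proof -
    obtain X1 X2 where eq: "X = (X1, X2)" and F: "X1 \<in> F" "X2 \<in> F"
      using X mem_CF by (cases X) auto
    show ?thesis
      using h k unfolding SF_iff
      by (simp add: fun_eq_iff complex_eq_iff eq Re_apply_cfield Im_apply_cfield F[THEN field_add])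
  qed
qed ((rule apply_cfield_commutator cR_eq cR_parallel nabla_pow_Cons; assumption) | simp add: assms)+

end

text \<open>Turns an updated argument list into the concatenation in which the sum over
  \<open>j\<close> is stated.\<close>

lemma list_update_map_upt:
  assumes "j < b - a"
  shows "(map Z [a..<b])[j := w] = map Z [a..<a + j] @ [w] @ map Z [a + j + 1..<b]"
  using assms by (simp add: upd_conv_take_nth_drop take_map drop_map take_upt drop_upt)

theorem theorem4p1:
  fixes A :: "'m::{t2_space, second_countable_topology} chart set"
    and g :: "'m \<Rightarrow> 'm tvec \<Rightarrow> 'm tvec \<Rightarrow> real"
    and nabla :: "'m set \<Rightarrow> 'm field \<Rightarrow> 'm field \<Rightarrow> 'm field"
    and K :: real
    and U :: "'m set"
    and f :: "'m \<Rightarrow> complex"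
    and n :: nat
    and Z :: "nat \<Rightarrow> 'm cfield"
  assumes "smooth_atlas A"
    and "connected (UNIV :: 'm set)"
    and "orientable A"
    and "riemannian_metric A g"
    and "complete_riemannian A g"
    and "levi_civita A g nabla"
    and "constant_sectional_curvature A g nabla K"
    and "K \<noteq> 0"
    and "open U"
    and "smooth_fun A U f"
    and "n \<ge> 3"
    and "\<forall>k\<in>{1..n}. Z k \<in> cvector_fields A U"
  shows "(\<forall>p\<in>U.
        nabla_pow (nabla U) n f (map Z [1..<n-1] @ [Z (n-1), Z n]) p
      - nabla_pow (nabla U) n f (map Z [1..<n-1] @ [Z n, Z (n-1)]) p = 0) \<and>
    (\<forall>i\<in>{1..n-2}. \<forall>p\<in>U.
        nabla_pow (nabla U) n f (map Z [1..<i] @ [Z i, Z (i+1)] @ map Z [i+2..<n+1]) p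
      - nabla_pow (nabla U) n f (map Z [1..<i] @ [Z (i+1), Z i] @ map Z [i+2..<n+1]) p
      = (\<Sum>j=i+2..n. nabla_pow (nabla U) (n-2) f
          (map Z [1..<i] @ map Z [i+2..<j]
           @ [- ccurvature A (nabla U) (Z i) (Z (i+1)) (Z j)] @ map Z [j+1..<n+1]) p))"
proof -
  interpret space_form_open A g nabla K U
    by unfold_locales (use assms in auto)
  interpret parallel_connection CF SF cD apply_cfield cR "\<lambda>n. nabla_pow D n f" f
    using assms by (intro parallel_connection)
  have Z: "Z k \<in> CF" if "1 \<le> k" "k \<le> n" for k
    using assms that by auto
  have "nabla_pow D n f (map Z [1..<n-1] @ [Z (n-1), Z n]) = nabla_pow D n f (map Z [1..<n-1] @ [Z n, Z (n-1)])"
  proof -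
    have "n - 2 + 2 = n"
      using \<open>n \<ge> 3\<close> by simp
    moreover have "length (map Z [1..<n-1]) = n - 2" "set (map Z [1..<n-1]) \<subseteq> CF" "Z (n-1) \<in> CF" "Z n \<in> CF"
      using Z \<open>n \<ge> 3\<close> by auto
    ultimately show ?thesis
      using N_symmetric by metis
  qed
  moreover have "nabla_pow D n f (map Z [1..<i] @ [Z i, Z (i+1)] @ map Z [i+2..<n+1]) p
      - nabla_pow D n f (map Z [1..<i] @ [Z (i+1), Z i] @ map Z [i+2..<n+1]) p
      = (\<Sum>j=i+2..n. nabla_pow D (n-2) f
          (map Z [1..<i] @ map Z [i+2..<j] @ [- cR (Z i) (Z (i+1)) (Z j)] @ map Z [j+1..<n+1]) p)"
    if i: "i \<in> {1..n-2}" for i p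
  proof -
    let ?Vs = "map Z [1..<i]" and ?Ws = "map Z [i+2..<n+1]" and ?r = "\<lambda>w. - cR (Z i) (Z (i+1)) w"
    \<comment> \<open>The arguments after the commuted pair are \<open>Z (i+2)\<close> to
      \<open>Z n\<close>, hence \<open>n - (i+1)\<close> of them.\<close>
    let ?l = "n - 1 - i"
    have sizes: "i - 1 + Suc (Suc ?l) = n" "i - 1 + ?l = n - 2"
      using i by auto
    have len: "length ?Vs = i - 1" "length ?Ws = ?l"
      using i by auto
    have mem: "set ?Vs \<subseteq> CF" "set ?Ws \<subseteq> CF" "Z i \<in> CF" "Z (i+1) \<in> CF"
      using i Z by auto
    have "nabla_pow D n f (?Vs @ [Z i, Z (i+1)] @ ?Ws) - nabla_pow D n f (?Vs @ [Z (i+1), Z i] @ ?Ws)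
        = (\<Sum>j<?l. nabla_pow D (n - 2) f (?Vs @ ?Ws[j := ?r (?Ws ! j)]))"
      using N_commute[OF len(1) mem len(2)] by (simp only: sizes slot_sum_def append.simps len(2))
    from fun_cong[OF this, of p]
    have "nabla_pow D n f (?Vs @ [Z i, Z (i+1)] @ ?Ws) p - nabla_pow D n f (?Vs @ [Z (i+1), Z i] @ ?Ws) p
        = (\<Sum>j<?l. nabla_pow D (n - 2) f (?Vs @ ?Ws[j := ?r (?Ws ! j)]) p)"
      by (simp only: minus_apply sum_fun_eval)
    \<comment> \<open>Slots are counted from 0, so slot \<open>j\<close> of \<open>?Ws\<close> holds
      \<open>Z (j + (i+2))\<close>.\<close>
    also have "\<dots> = (\<Sum>j=i+2..n. nabla_pow D (n-2) f (?Vs @ map Z [i+2..<j] @ [?r (Z j)] @ map Z [j+1..<n+1]) p)"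
      using i
      by (intro sum.reindex_bij_witness[of _ "\<lambda>j. j - (i+2)" "\<lambda>j. j + (i+2)"])
        (auto simp: list_update_map_upt add_ac simp del: upt_Suc)
    finally show ?thesis .
  qed
  ultimately show ?thesis
    by simp
qed

end
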